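(* Let $P$ and $Q$ be two precubical sets such that $\mathrm{Extrl}(P)=\mathrm{Extrl}(Q)$ and let $f:|P|\to|Q|$ be a dihomotopy equivalence relative to $|\mathrm{Extrl}(P)|$. Then the functor $\vec\pi_1(f):\vec\pi_1(|P|)\to\vec\pi_1(|Q|)$ restricts to an isomorphism of fundamental bipartite graphs $\vec\pi_1(|P|,\mathrm{Extrl}(|P|))\to\vec\pi_1(|Q|,\mathrm{Extrl}(|Q|))$. Moreover, for any two elements $v,w\in\mathrm{Extrl}(P)$ the map $f^I:|P|^I\to|Q|^I$, $\omega\mapsto f\circ\omega$ restricts to a homotopy equivalence $\vec{\mathcal P}(|P|)([v,()],[w,()])\to\vec{\mathcal P}(|Q|)([v,()],[w,()])$.
   Context: Precubical sets. $I=[0,1]$. A precubical set is a graded set $P=(P_n)_{n\ge 0}$ with boundary operators $d_i^k: P_n \to P_{n-1}$ ($n>0$, $k=0,1$, $i=1,\dots,n$) satisfying $d_i^k\circ d_j^l = d_{j-1}^l\circ d_i^k$ ($k,l=0,1$, $i<j$). A precubical subset of $P$ is a precubical set $Q$ with $Q_n\subseteq P_n$ for all $n$ whose boundary operators coincide with those of $P$ on $Q$. A vertex $v\in P_0$ is minimal (maximal) if there is no $x\in P_1$ with $d_1^1x=v$ ($d_1^0x=v$); it is extremal if it is minimal or maximal. $\mathrm{Extrl}(P)$ is the $0$-dimensional precubical subset of $P$ of extremal elements. d-spaces. A d-space is a topological space $X$ with a set $dX\subseteq X^I$ of paths (called d-paths) containing all constant paths and closed under composition with (not necessarily strictly) increasing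 continuous maps $I\to I$ and under concatenation. A d-map is a continuous map $f$ between d-spaces such that $f\circ\omega$ is a d-path for each d-path $\omega$. A d-subspace $A$ of $X$ is a subspace with $dA=\{\omega\in A^I \mid \omega \text{ is a d-path when regarded as a path in } X\}$. Geometric realization. For $i\in\{1,\dots,n+1\}$, $k\in\{0,1\}$ let $\delta_i^k:I^n\to I^{n+1}$, $\delta_i^k(u_1,\dots,u_n)=(u_1,\dots,u_{i-1},k,u_i,\dots,u_n)$; $I^0=\{()\}$. $|P|=(\coprod_{n\ge 0}P_n\times I^n)/\sim$ with $P_n$ discrete and $\sim$ generated by $(d_i^kx,u)\sim(x,\delta_i^k(u))$; classes are written $[x,u]$. Its d-paths are the increasing reparametrizations of finite concatenations of paths of the form $t\mapsto[x,\alpha(t)]$, where $x\in P_n$ and $\alpha:I\to I^n$ is continuous and order-preserving (componentwise order on $I^n$). If $R$ is a precubical subset of $P$, then $|R|$ is regarded as a d-subspace of $|P|$; thus here $|\mathrm{Extrl}(P)|$ is a common d-subspace of $|P|$ and $|Q|$. Dihomotopy. For d-maps $f,g:X\to Y$ coinciding on a d-subspace $A$ of $X$, a dihomotopy relative to $A$ from $f$ to $g$ is a homotopy $H:X\times I\to Y$ from $f$ to $g$ such that each $H(-,t)$ is a d-map which coincides with $f$ and $g$ on $A$; $f,g$ are then called dihomotopic relative to $A$. If $X$ and $Y$ are d-spaces with a common d-subspace $A$, a d-map $f:X\to Y$ with $f(a)=a$ for all $a\in A$ is a dihomotopy equivalence relative to $A$ if there is a d-map $g:Y\to X$ with $g(a)=a$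 for all $a\in A$ such that $g\circ f$ and $f\circ g$ are dihomotopic relative to $A$ to the identities. Fundamental bipartite graph. The fundamental category $\vec\pi_1(X)$ of a d-space $X$ has the points of $X$ as objects and, as morphisms from $x$ to $y$, the dihomotopy classes relative to $\{0,1\}$ (endpoints fixed) of d-paths from $x$ to $y$ (composition by concatenation); it is functorial in d-maps. A point $a\in X$ is minimal (maximal) if any morphism in $\vec\pi_1(X)$ with target (source) $a$ has source (target) $a$, and extremal if it is minimal or maximal; $\mathrm{Extrl}(X)$ is the d-subspace of extremal points. The fundamental bipartite graph of $X$ is the full subcategory $\vec\pi_1(X,\mathrm{Extrl}(X))$ of $\vec\pi_1(X)$ on $\mathrm{Extrl}(X)$. For $a,b\in X$, the d-path space $\vec{\mathcal P}(X)(a,b)$ is the subspace of $X^I$ (compact-open topology) of d-paths from $a$ to $b$. *)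

theory Defs
  imports "HOL-Analysis.Analysis"
begin

section \<open>Precubical sets\<close>

text \<open>\<open>face P n i k\<close> is the boundary operator \<open>d\<^sub>i\<^sup>k : P\<^sub>n \<rightarrow> P\<^sub>n\<^sub>-\<^sub>1\<close>, for \<open>1 \<le> i \<le> n\<close> and \<open>k \<in> {0,1}\<close>.
  The degree is an explicit argument because the sets \<open>P\<^sub>n\<close> need not be disjoint.\<close>

record 'a precubical =
  cells :: "nat \<Rightarrow> 'a set"
  face :: "nat \<Rightarrow> nat \<Rightarrow> nat \<Rightarrow> 'a \<Rightarrow> 'a"

definition precubical_set :: "'a precubical \<Rightarrow> bool" where
  "precubical_set P \<longleftrightarrow>
     (\<forall>n\<ge>1. \<forall>i\<in>{1..n}. \<forall>k\<in>{0,1}. \<forall>x\<in>cells P n. face P n i k x \<in> cells P (n - 1)) \<and>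
     (\<forall>n\<ge>2. \<forall>j\<in>{1..n}. \<forall>i\<in>{1..<j}. \<forall>k\<in>{0,1}. \<forall>l\<in>{0,1}. \<forall>x\<in>cells P n.
        face P (n - 1) i k (face P n j l x) = face P (n - 1) (j - 1) l (face P n i k x))"

definition precubical_subset :: "'a precubical \<Rightarrow> 'a precubical \<Rightarrow> bool" where
  "precubical_subset R P \<longleftrightarrow> precubical_set R \<and> (\<forall>n. cells R n \<subseteq> cells P n) \<and>
     (\<forall>n\<ge>1. \<forall>i\<in>{1..n}. \<forall>k\<in>{0,1}. \<forall>x\<in>cells R n. face R n i k x = face P n i k x)"

definition minimal_vertex :: "'a precubical \<Rightarrow> 'a \<Rightarrow> bool" where
  "minimal_vertex P v \<longleftrightarrow> v \<in> cells P 0 \<and> (\<nexists>x. x \<in> cells P 1 \<and> face P 1 1 1 x = v)"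

definition maximal_vertex :: "'a precubical \<Rightarrow> 'a \<Rightarrow> bool" where
  "maximal_vertex P v \<longleftrightarrow> v \<in> cells P 0 \<and> (\<nexists>x. x \<in> cells P 1 \<and> face P 1 1 0 x = v)"

text \<open>There are no cells of positive degree, hence no boundary operators; setting the
  \<open>face\<close> field to \<^term>\<open>undefined\<close> makes equality of records equality of precubical sets.\<close>

definition Extrl :: "'a precubical \<Rightarrow> 'a precubical" where
  "Extrl P = \<lparr>cells = (\<lambda>n. if n = 0 then {v. minimal_vertex P v \<or> maximal_vertex P v} else {}),
              face = (\<lambda>_ _ _ _. undefined)\<rparr>"

lemma precubical_subset_Extrl: "precubical_subset (Extrl P) P"
  by (auto simp: precubical_subset_def precubical_set_def Extrl_def minimal_vertex_def
      maximal_vertex_def)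


section \<open>d-spaces\<close>

abbreviation unit_interval :: "real set" (\<open>\<I>\<close>)
  where "\<I> \<equiv> {0..1}"

text \<open>The set \<open>X\<^sup>I\<close>. A path is represented by the function on \<^typ>\<open>real\<close> that is
  \<^term>\<open>undefined\<close> outside the unit interval, so that equality of functions is equality of paths;
  accordingly \<open>f \<circ> \<omega>\<close> is rendered as \<^term>\<open>compose \<I> f \<omega>\<close>.\<close>

definition paths :: "'b topology \<Rightarrow> (real \<Rightarrow> 'b) set" where
  "paths T = {\<omega> \<in> extensional \<I>. pathin T \<omega>}"

definition increasing_maps :: "(real \<Rightarrow> real) set" where
  "increasing_maps = {\<phi> \<in> paths (top_of_set \<I>). mono_on \<I> \<phi>}"

definition concat_path :: "(real \<Rightarrow> 'b) \<Rightarrow> (real \<Rightarrow> 'b) \<Rightarrow> real \<Rightarrow> 'b" where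
  "concat_path \<omega> \<nu> = (\<lambda>t\<in>\<I>. if t \<le> 1/2 then \<omega> (2 * t) else \<nu> (2 * t - 1))"

record 'b dspace =
  dtop :: "'b topology"
  dpaths :: "(real \<Rightarrow> 'b) set"

abbreviation dpoints :: "'b dspace \<Rightarrow> 'b set" where
  "dpoints X \<equiv> topspace (dtop X)"

definition d_space :: "'b dspace \<Rightarrow> bool" where
  "d_space X \<longleftrightarrow> dpaths X \<subseteq> paths (dtop X) \<and>
     (\<forall>a\<in>dpoints X. (\<lambda>t\<in>\<I>. a) \<in> dpaths X) \<and>
     (\<forall>\<omega>\<in>dpaths X. \<forall>\<phi>\<in>increasing_maps. compose \<I> \<omega> \<phi> \<in> dpaths X) \<and>
     (\<forall>\<omega>\<in>dpaths X. \<forall>\<nu>\<in>dpaths X. \<omega> 1 = \<nu> 0 \<longrightarrow> concat_path \<omega> \<nu> \<in> dpaths X)"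

definition d_map :: "'b dspace \<Rightarrow> 'c dspace \<Rightarrow> ('b \<Rightarrow> 'c) \<Rightarrow> bool" where
  "d_map X Y f \<longleftrightarrow> continuous_map (dtop X) (dtop Y) f \<and>
     (\<forall>\<omega>\<in>dpaths X. compose \<I> f \<omega> \<in> dpaths Y)"

definition directed_interval :: "real dspace" where
  "directed_interval = \<lparr>dtop = top_of_set \<I>, dpaths = increasing_maps\<rparr>"

text \<open>Existence of a dihomotopy relative to \<open>A\<close>. Taking \<open>t = 0\<close> and \<open>t = 1\<close> in the condition on
  the intermediate maps shows that \<open>f\<close> and \<open>g\<close> are d-maps which coincide on \<open>A\<close>.\<close>

definition dihomotopic_rel ::
    "'b set \<Rightarrow> 'b dspace \<Rightarrow> 'c dspace \<Rightarrow> ('b \<Rightarrow> 'c) \<Rightarrow> ('b \<Rightarrow> 'c) \<Rightarrow> bool" where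
  "dihomotopic_rel A X Y f g \<longleftrightarrow>
     homotopic_with (\<lambda>h. d_map X Y h \<and> (\<forall>a\<in>A. h a = f a \<and> h a = g a)) (dtop X) (dtop Y) f g"

text \<open>The maps \<open>\<iota>\<close> and \<open>\<kappa>\<close> are the inclusions into \<open>X\<close> and \<open>Y\<close> of the common d-subspace with
  underlying set \<open>A\<close>; they are needed because, for geometric realizations, the points of the
  common d-subspace are represented by different equivalence classes in \<open>X\<close> and in \<open>Y\<close>.\<close>

definition dihomotopy_equivalence_rel ::
    "'d set \<Rightarrow> ('d \<Rightarrow> 'b) \<Rightarrow> ('d \<Rightarrow> 'c) \<Rightarrow> 'b dspace \<Rightarrow> 'c dspace \<Rightarrow> ('b \<Rightarrow> 'c) \<Rightarrow> bool" where
  "dihomotopy_equivalence_rel A \<iota> \<kappa> X Y f \<longleftrightarrow>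
     d_map X Y f \<and> (\<forall>a\<in>A. f (\<iota> a) = \<kappa> a) \<and>
     (\<exists>g. d_map Y X g \<and> (\<forall>a\<in>A. g (\<kappa> a) = \<iota> a) \<and>
          dihomotopic_rel (\<iota> ` A) X X (g \<circ> f) id \<and>
          dihomotopic_rel (\<kappa> ` A) Y Y (f \<circ> g) id)"

text \<open>\<open>X\<^sup>I\<close> with the compact-open topology.\<close>

definition path_space :: "'b topology \<Rightarrow> (real \<Rightarrow> 'b) topology" where
  "path_space T = topology_generated_by
     {{\<omega> \<in> paths T. \<omega> ` K \<subseteq> U} | K U. compact K \<and> K \<subseteq> \<I> \<and> openin T U}"

definition dpath_space :: "'b dspace \<Rightarrow> 'b \<Rightarrow> 'b \<Rightarrow> (real \<Rightarrow> 'b) topology" where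
  "dpath_space X a b = subtopology (path_space (dtop X)) {\<omega> \<in> dpaths X. \<omega> 0 = a \<and> \<omega> 1 = b}"

text \<open>The library only has the relation \<^const>\<open>homotopy_equivalent_space\<close>, not the predicate on maps.\<close>

definition homotopy_equivalence_map :: "'b topology \<Rightarrow> 'c topology \<Rightarrow> ('b \<Rightarrow> 'c) \<Rightarrow> bool" where
  "homotopy_equivalence_map S T f \<longleftrightarrow> continuous_map S T f \<and>
     (\<exists>g. continuous_map T S g \<and> homotopic_with (\<lambda>_. True) S S (g \<circ> f) id \<and>
          homotopic_with (\<lambda>_. True) T T (f \<circ> g) id)"


section \<open>Geometric realization\<close>

text \<open>The cube \<open>I\<^sup>n\<close> consists of functions on \<open>{1..n}\<close>, \<^term>\<open>undefined\<close> elsewhere; the unique point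
  of \<open>I\<^sup>0\<close> is \<^term>\<open>\<lambda>_. undefined\<close>.\<close>

definition cube :: "nat \<Rightarrow> (nat \<Rightarrow> real) topology" where
  "cube n = product_topology (\<lambda>_. top_of_set \<I>) {1..n}"

text \<open>\<open>cube_face n i k\<close> is \<open>\<delta>\<^sub>i\<^sup>k : I\<^sup>n \<rightarrow> I\<^sup>n\<^sup>+\<^sup>1\<close>.\<close>

definition cube_face :: "nat \<Rightarrow> nat \<Rightarrow> nat \<Rightarrow> (nat \<Rightarrow> real) \<Rightarrow> (nat \<Rightarrow> real)" where
  "cube_face n i k u =
     (\<lambda>j\<in>{1..n + 1}. if j < i then u j else if j = i then real k else u (j - 1))"

text \<open>The coproduct of the spaces \<open>P\<^sub>n \<times> I\<^sup>n\<close>; the point \<open>(x, u)\<close> of \<open>P\<^sub>n \<times> I\<^sup>n\<close> is \<open>((n, x), u)\<close>.\<close>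

definition cube_sum :: "'a precubical \<Rightarrow> ((nat \<times> 'a) \<times> (nat \<Rightarrow> real)) topology" where
  "cube_sum P = sum_topology (\<lambda>(n, x). cube n) (SIGMA n:UNIV. cells P n)"

definition glue ::
    "'a precubical \<Rightarrow> (nat \<times> 'a) \<times> (nat \<Rightarrow> real) \<Rightarrow> (nat \<times> 'a) \<times> (nat \<Rightarrow> real) \<Rightarrow> bool" where
  "glue P p q \<longleftrightarrow> (\<exists>n. \<exists>x\<in>cells P (n + 1). \<exists>u\<in>topspace (cube n). \<exists>i\<in>{1..n + 1}. \<exists>k\<in>{0,1}.
     p = ((n, face P (n + 1) i k x), u) \<and> q = ((n + 1, x), cube_face n i k u))"

type_synonym 'a rpoint = "((nat \<times> 'a) \<times> (nat \<Rightarrow> real)) set"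

definition rclass :: "'a precubical \<Rightarrow> (nat \<times> 'a) \<times> (nat \<Rightarrow> real) \<Rightarrow> 'a rpoint" where
  "rclass P p = {q. equivclp (glue P) p q}"

definition realization_top :: "'a precubical \<Rightarrow> 'a rpoint topology" where
  "realization_top P = topology (\<lambda>U. U \<subseteq> rclass P ` topspace (cube_sum P) \<and>
     openin (cube_sum P) {p \<in> topspace (cube_sum P). rclass P p \<in> U})"

text \<open>Paths of the form \<open>t \<mapsto> [x, \<alpha>(t)]\<close> and their finite concatenations.\<close>

inductive_set cube_path_concats :: "'a precubical \<Rightarrow> (real \<Rightarrow> 'a rpoint) set"
  for P :: "'a precubical" where
  cube_path: "\<lbrakk>x \<in> cells P n; \<alpha> \<in> paths (cube n);
     \<forall>s\<in>\<I>. \<forall>t\<in>\<I>. s \<le> t \<longrightarrow> (\<forall>i\<in>{1..n}. \<alpha> s i \<le> \<alpha> t i)\<rbrakk>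
     \<Longrightarrow> (\<lambda>t\<in>\<I>. rclass P ((n, x), \<alpha> t)) \<in> cube_path_concats P"
| concat: "\<lbrakk>\<omega> \<in> cube_path_concats P; \<nu> \<in> cube_path_concats P; \<omega> 1 = \<nu> 0\<rbrakk>
     \<Longrightarrow> concat_path \<omega> \<nu> \<in> cube_path_concats P"

definition realization :: "'a precubical \<Rightarrow> 'a rpoint dspace" where
  "realization P = \<lparr>dtop = realization_top P,
     dpaths = {compose \<I> \<omega> \<phi> | \<omega> \<phi>. \<omega> \<in> cube_path_concats P \<and> \<phi> \<in> increasing_maps}\<rparr>"

text \<open>The point \<open>[v, ()]\<close>.\<close>

definition vertex_point :: "'a precubical \<Rightarrow> 'a \<Rightarrow> 'a rpoint" where
  "vertex_point P v = rclass P ((0, v), \<lambda>_. undefined)"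

text \<open>The inclusion \<open>|R| \<rightarrow> |P|\<close>, \<open>[x,u] \<mapsto> [x,u]\<close>, for a precubical subset \<open>R\<close> of \<open>P\<close>: it sends a
  class in \<open>|R|\<close> to the class in \<open>|P|\<close> that contains it.\<close>

definition realization_incl :: "'a precubical \<Rightarrow> 'a rpoint \<Rightarrow> 'a rpoint" where
  "realization_incl P c = (\<Union>p\<in>c. rclass P p)"


subsection \<open>The realization is a d-space containing the realizations of precubical subsets\<close>

lemma quotient_map_rclass: "quotient_map (cube_sum P) (realization_top P) (rclass P)"
proof -
  let ?X = "cube_sum P"
  let ?L = "\<lambda>U. U \<subseteq> rclass P ` topspace ?X \<and> openin ?X {p \<in> topspace ?X. rclass P p \<in> U}"
  have "istopology ?L"
    unfolding istopology_def
  proof (intro conjI allI impI)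
    fix S T assume "?L S" "?L T"
    moreover have "{p \<in> topspace ?X. rclass P p \<in> S \<inter> T} =
      {p \<in> topspace ?X. rclass P p \<in> S} \<inter> {p \<in> topspace ?X. rclass P p \<in> T}" by blast
    ultimately show "openin ?X {p \<in> topspace ?X. rclass P p \<in> S \<inter> T}"
      by (simp add: openin_Int)
  next
    fix S T assume "?L S" "?L T"
    then show "S \<inter> T \<subseteq> rclass P ` topspace ?X" by blast
  next
    fix \<K> assume "\<forall>K\<in>\<K>. ?L K"
    then show "\<Union>\<K> \<subseteq> rclass P ` topspace ?X" by blast
  next
    fix \<K> assume *: "\<forall>K\<in>\<K>. ?L K"
    have "{p \<in> topspace ?X. rclass P p \<in> \<Union>\<K>} = (\<Union>K\<in>\<K>. {p \<in> topspace ?X. rclass P p \<in> K})"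
      by blast
    then show "openin ?X {p \<in> topspace ?X. rclass P p \<in> \<Union>\<K>}"
      using * by auto
  qed
  then have op: "openin (realization_top P) U \<longleftrightarrow> ?L U" for U
    by (simp add: realization_top_def)
  have "{p \<in> topspace ?X. rclass P p \<in> rclass P ` topspace ?X} = topspace ?X" by blast
  then have "?L (rclass P ` topspace ?X)" by simp
  then have 1: "rclass P ` topspace ?X \<subseteq> topspace (realization_top P)"
    using openin_subset op by blast
  have 2: "topspace (realization_top P) \<subseteq> rclass P ` topspace ?X"
    using op[of "topspace (realization_top P)"] by simp
  from 1 2 have "topspace (realization_top P) = rclass P ` topspace ?X" by blast
  then show ?thesis
    unfolding quotient_map_def using op by simp
qed

lemma concat_path_paths:
  assumes "\<omega> \<in> paths T" "\<nu> \<in> paths T" "\<omega> 1 = \<nu> 0"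
  shows "concat_path \<omega> \<nu> \<in> paths T"
proof -
  have c: "continuous_map (top_of_set \<I>) T \<omega>" "continuous_map (top_of_set \<I>) T \<nu>"
    using assms by (auto simp: paths_def pathin_def)
  have "continuous_map (top_of_set \<I>) T (\<lambda>t. if t \<le> 1/2 then \<omega> (2 * t) else \<nu> (2 * t - 1))"
  proof (rule continuous_map_cases_le)
    have "continuous_map (subtopology (top_of_set \<I>) {x \<in> topspace (top_of_set \<I>). x \<le> 1/2})
        (top_of_set \<I>) ((*) 2)"
      unfolding subtopology_subtopology continuous_map_subtopology_eu
      by (auto intro!: continuous_on_mult_left continuous_on_id)
    from continuous_map_compose[OF this c(1)]
    show "continuous_map (subtopology (top_of_set \<I>) {x \<in> topspace (top_of_set \<I>). x \<le> 1/2}) T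
           (\<lambda>x. \<omega> (2 * x))"
      by (simp only: o_def)
    have "continuous_map (subtopology (top_of_set \<I>) {x \<in> topspace (top_of_set \<I>). 1/2 \<le> x})
        (top_of_set \<I>) (\<lambda>x. 2 * x - 1)"
      unfolding subtopology_subtopology continuous_map_subtopology_eu
      by (auto intro!: continuous_on_mult_left continuous_on_id continuous_on_diff continuous_on_const)
    from continuous_map_compose[OF this c(2)]
    show "continuous_map (subtopology (top_of_set \<I>) {x \<in> topspace (top_of_set \<I>). 1/2 \<le> x}) T
           (\<lambda>x. \<nu> (2 * x - 1))"
      by (simp only: o_def)
    show "\<omega> (2 * x) = \<nu> (2 * x - 1)" if "x = 1/2" for x :: real
      unfolding that using assms(3) by simp
  qed (simp_all add: continuous_map_from_subtopology)
  then have "continuous_map (top_of_set \<I>) T (concat_path \<omega> \<nu>)"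
    by (rule continuous_map_eq) (auto simp: concat_path_def)
  then show ?thesis
    unfolding paths_def pathin_def concat_path_def by (simp del: restrict_apply)
qed

lemma continuous_on_restrict_iff:
  "continuous_on S (restrict f S) \<longleftrightarrow> continuous_on S f" for f :: "real \<Rightarrow> real"
  by (rule continuous_on_cong) auto

lemma increasing_maps_iff:
  "\<phi> \<in> increasing_maps \<longleftrightarrow>
     \<phi> \<in> extensional \<I> \<and> continuous_on \<I> \<phi> \<and> \<phi> ` \<I> \<subseteq> \<I> \<and> mono_on \<I> \<phi>"
  by (auto simp: increasing_maps_def paths_def pathin_def)

lemma increasing_mapsI:
  assumes "\<phi> \<in> extensional \<I>" "continuous_on \<I> \<phi>"
    and "\<And>t. t \<in> \<I> \<Longrightarrow> 0 \<le> \<phi> t \<and> \<phi> t \<le> 1"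
    and "\<And>s t. s \<in> \<I> \<Longrightarrow> t \<in> \<I> \<Longrightarrow> s \<le> t \<Longrightarrow> \<phi> s \<le> \<phi> t"
  shows "\<phi> \<in> increasing_maps"
  using assms by (auto simp: increasing_maps_iff mono_on_def)

lemma restrict_id_increasing: "(\<lambda>t\<in>\<I>. t) \<in> increasing_maps"
proof (rule increasing_mapsI[OF restrict_extensional])
  show "continuous_on \<I> (\<lambda>t\<in>\<I>. t)"
    unfolding continuous_on_restrict_iff by (rule continuous_on_id)
qed auto

lemma compose_paths:
  assumes "\<omega> \<in> paths T" "\<phi> \<in> increasing_maps"
  shows "compose \<I> \<omega> \<phi> \<in> paths T"
proof -
  have "continuous_map (top_of_set \<I>) T (\<omega> \<circ> \<phi>)"
    using assms by (intro continuous_map_compose[of _ "top_of_set \<I>"])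
      (auto simp: paths_def pathin_def increasing_maps_iff)
  then have "continuous_map (top_of_set \<I>) T (compose \<I> \<omega> \<phi>)"
    by (rule continuous_map_eq) (auto simp: compose_def)
  then show ?thesis
    unfolding paths_def pathin_def compose_def by (simp del: restrict_apply)
qed

lemma cube_path_concats_paths:
  "\<omega> \<in> cube_path_concats P \<Longrightarrow> \<omega> \<in> paths (realization_top P)"
proof (induction rule: cube_path_concats.induct)
  case (cube_path x n \<alpha>)
  have 1: "continuous_map (cube n) (cube_sum P) (Pair (n, x))"
    using continuous_map_component_injection[of "(n, x)" "SIGMA n:UNIV. cells P n" "\<lambda>(n, x). cube n"]
      cube_path(1) by (simp add: cube_sum_def)
  have 2: "continuous_map (top_of_set \<I>) (cube n) \<alpha>"
    using cube_path(2) by (simp add: paths_def pathin_def)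
  have "continuous_map (top_of_set \<I>) (realization_top P) (rclass P \<circ> (Pair (n, x) \<circ> \<alpha>))"
    by (rule continuous_map_compose[OF continuous_map_compose[OF 2 1]
          quotient_imp_continuous_map[OF quotient_map_rclass]])
  then have "continuous_map (top_of_set \<I>) (realization_top P) (\<lambda>t\<in>\<I>. rclass P ((n, x), \<alpha> t))"
    by (rule continuous_map_eq) auto
  then show ?case
    by (simp only: paths_def pathin_def mem_Collect_eq restrict_extensional simp_thms)
next
  case (concat \<omega> \<nu>)
  show ?case by (rule concat_path_paths[OF concat.IH concat.hyps(3)])
qed

text \<open>Pasting of two increasing maps at \<open>c\<close>.\<close>

lemma increasing_paste:
  assumes "\<psi> \<in> increasing_maps" "\<xi> \<in> increasing_maps" "0 < c" "c < 1" "\<psi> 1 = 1" "\<xi> 0 = 0"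
  shows "(\<lambda>t\<in>\<I>. if t \<le> c then \<psi> (t / c) / 2 else (1 + \<xi> ((t - c) / (1 - c))) / 2)
           \<in> increasing_maps" (is "?\<rho> \<in> _")
proof -
  have \<psi>: "continuous_on \<I> \<psi>" "mono_on \<I> \<psi>" "\<And>t. t \<in> \<I> \<Longrightarrow> 0 \<le> \<psi> t \<and> \<psi> t \<le> 1"
    using assms by (auto simp: increasing_maps_iff image_subset_iff)
  have \<xi>: "continuous_on \<I> \<xi>" "mono_on \<I> \<xi>" "\<And>t. t \<in> \<I> \<Longrightarrow> 0 \<le> \<xi> t \<and> \<xi> t \<le> 1"
    using assms by (auto simp: increasing_maps_iff image_subset_iff)
  have l: "t / c \<in> \<I>" if "0 \<le> t" "t \<le> c" for t using that assms by auto
  have r: "(t - c) / (1 - c) \<in> \<I>" if "c \<le> t" "t \<le> 1" for t using that assms by auto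
  have un: "{0..c} \<union> {c..1} = \<I>" using assms by auto
  have "continuous_on ({0..c} \<union> {c..1})
     (\<lambda>t. if t \<le> c then \<psi> (t / c) / 2 else (1 + \<xi> ((t - c) / (1 - c))) / 2)"
  proof (rule continuous_on_cases)
    show "continuous_on {0..c} (\<lambda>t. \<psi> (t / c) / 2)"
      by (intro continuous_intros continuous_on_compose2[OF \<psi>(1)]) (use assms l in auto)
    show "continuous_on {c..1} (\<lambda>t. (1 + \<xi> ((t - c) / (1 - c))) / 2)"
      by (intro continuous_intros continuous_on_compose2[OF \<xi>(1)]) (use assms r in auto)
  qed (use assms in auto)
  then have "continuous_on \<I> ?\<rho>"
    unfolding continuous_on_restrict_iff un .
  moreover have "0 \<le> ?\<rho> t \<and> ?\<rho> t \<le> 1" if "t \<in> \<I>" for t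
    using \<psi>(3)[OF l[of t]] \<xi>(3)[OF r[of t]] that by auto
  moreover have "?\<rho> s \<le> ?\<rho> t" if st: "s \<in> \<I>" "t \<in> \<I>" "s \<le> t" for s t
  proof -
    consider "t \<le> c" | "s \<le> c" "c < t" | "c < s" by linarith
    then show ?thesis
    proof cases
      case 1
      have "\<psi> (s / c) \<le> \<psi> (t / c)"
        by (rule mono_onD[OF \<psi>(2)]) (use l 1 st assms in \<open>auto simp: divide_right_mono\<close>)
      then show ?thesis using 1 st by auto
    next
      case 2
      then show ?thesis using \<psi>(3)[OF l[of s]] \<xi>(3)[OF r[of t]] st by auto
    next
      case 3
      have "\<xi> ((s - c) / (1 - c)) \<le> \<xi> ((t - c) / (1 - c))"
        by (rule mono_onD[OF \<xi>(2)]) (use r 3 st assms in \<open>auto simp: divide_right_mono\<close>)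
      then show ?thesis using 3 st by auto
    qed
  qed
  ultimately show ?thesis
    by (rule increasing_mapsI[OF restrict_extensional])
qed

lemma compose_concat_paste:
  assumes "\<psi> \<in> increasing_maps" "\<xi> \<in> increasing_maps" "0 < c" "c < 1" "\<psi> 1 = 1" "\<xi> 0 = 0"
    and "\<omega> 1 = \<nu> 0"
  shows "compose \<I> (concat_path \<omega> \<nu>)
      (\<lambda>t\<in>\<I>. if t \<le> c then \<psi> (t / c) / 2 else (1 + \<xi> ((t - c) / (1 - c))) / 2)
    = (\<lambda>t\<in>\<I>. if t \<le> c then \<omega> (\<psi> (t / c)) else \<nu> (\<xi> ((t - c) / (1 - c))))"
proof
  fix t
  have "0 \<le> \<psi> (t / c) \<and> \<psi> (t / c) \<le> 1" if "0 \<le> t" "t \<le> c"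
    using assms that by (auto simp: increasing_maps_iff image_subset_iff)
  moreover have "0 \<le> \<xi> ((t - c) / (1 - c)) \<and> \<xi> ((t - c) / (1 - c)) \<le> 1" if "c \<le> t" "t \<le> 1"
    using assms that by (auto simp: increasing_maps_iff image_subset_iff)
  ultimately show "compose \<I> (concat_path \<omega> \<nu>)
      (\<lambda>t\<in>\<I>. if t \<le> c then \<psi> (t / c) / 2 else (1 + \<xi> ((t - c) / (1 - c))) / 2) t
    = (\<lambda>t\<in>\<I>. if t \<le> c then \<omega> (\<psi> (t / c)) else \<nu> (\<xi> ((t - c) / (1 - c)))) t"
    using assms by (auto simp: compose_def concat_path_def add_divide_distrib)
qed

lemma increasing_affine:
  assumes "\<phi> \<in> increasing_maps" "0 \<le> a" "0 \<le> m" "a + m \<le> 1"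
    and "\<And>t. t \<in> {a..a + m} \<Longrightarrow> 2 * \<phi> t - b \<in> \<I>"
  shows "(\<lambda>t\<in>\<I>. 2 * \<phi> (a + m * t) - b) \<in> increasing_maps"
proof -
  have \<phi>: "continuous_on \<I> \<phi>" "mono_on \<I> \<phi>"
    using assms by (auto simp: increasing_maps_iff)
  have s: "a + m * t \<in> {a..a + m}" if "t \<in> \<I>" for t
    using that assms by (auto intro: mult_left_le)
  then have s': "a + m * t \<in> \<I>" if "t \<in> \<I>" for t
    using that assms by fastforce
  have "continuous_on \<I> (\<lambda>t. 2 * \<phi> (a + m * t) - b)"
    by (intro continuous_intros continuous_on_compose2[OF \<phi>(1)] image_subsetI s')
  then have "continuous_on \<I> (\<lambda>t\<in>\<I>. 2 * \<phi> (a + m * t) - b)"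
    unfolding continuous_on_restrict_iff .
  moreover have "\<phi> (a + m * t) \<le> \<phi> (a + m * t')" if "t \<in> \<I>" "t' \<in> \<I>" "t \<le> t'" for t t'
    by (rule mono_onD[OF \<phi>(2)]) (use s' that assms in \<open>simp_all add: mult_left_mono\<close>)
  moreover have "2 * \<phi> (a + m * t) - b \<in> \<I>" if "t \<in> \<I>" for t
    using assms(5) s that by blast
  ultimately show ?thesis
    by (intro increasing_mapsI[OF restrict_extensional]) auto
qed

text \<open>The reparametrization of a finite concatenation may be taken to fix the end points.\<close>

lemma cube_path_concats_normalize:
  assumes "\<omega> \<in> cube_path_concats P" "\<phi> \<in> increasing_maps"
  shows "\<exists>\<nu>\<in>cube_path_concats P. \<exists>\<psi>\<in>increasing_maps. \<psi> 0 = 0 \<and> \<psi> 1 = 1 \<and>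
           compose \<I> \<omega> \<phi> = compose \<I> \<nu> \<psi>"
  using assms
proof (induction arbitrary: \<phi> rule: cube_path_concats.induct)
  case (cube_path x n \<alpha>)
  have \<phi>: "\<And>t. t \<in> \<I> \<Longrightarrow> 0 \<le> \<phi> t \<and> \<phi> t \<le> 1" "mono_on \<I> \<phi>"
    using cube_path.prems by (auto simp: increasing_maps_iff image_subset_iff)
  let ?\<beta> = "compose \<I> \<alpha> \<phi>"
  have "(\<lambda>t\<in>\<I>. rclass P ((n, x), ?\<beta> t)) \<in> cube_path_concats P"
  proof (rule cube_path_concats.cube_path)
    show "?\<beta> \<in> paths (cube n)" using compose_paths cube_path by blast
    show "\<forall>s\<in>\<I>. \<forall>t\<in>\<I>. s \<le> t \<longrightarrow> (\<forall>i\<in>{1..n}. ?\<beta> s i \<le> ?\<beta> t i)"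
      using cube_path(3) \<phi>(1) mono_onD[OF \<phi>(2)] by (auto simp: compose_def)
  qed (use cube_path in auto)
  moreover note restrict_id_increasing
  moreover have "compose \<I> (\<lambda>t\<in>\<I>. rclass P ((n, x), \<alpha> t)) \<phi> =
      compose \<I> (\<lambda>t\<in>\<I>. rclass P ((n, x), ?\<beta> t)) (\<lambda>t\<in>\<I>. t)"
    using \<phi> by (auto simp: compose_def fun_eq_iff)
  moreover have "(\<lambda>t\<in>\<I>. t) 0 = (0::real)" "(\<lambda>t\<in>\<I>. t) 1 = (1::real)"
    by simp_all
  ultimately show ?case by blast
next
  case (concat \<omega> \<nu>)
  have \<phi>: "\<And>t. t \<in> \<I> \<Longrightarrow> 0 \<le> \<phi> t \<and> \<phi> t \<le> 1" "mono_on \<I> \<phi>" "continuous_on \<I> \<phi>"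
    using concat.prems by (auto simp: increasing_maps_iff image_subset_iff)
  have mono: "\<phi> s \<le> \<phi> t" if "0 \<le> s" "s \<le> t" "t \<le> 1" for s t
    using mono_onD[OF \<phi>(2), of s t] that by auto
  consider "\<phi> 1 \<le> 1/2" | "1/2 \<le> \<phi> 0" | "\<phi> 0 < 1/2" "1/2 < \<phi> 1" by linarith
  then show ?case
  proof cases
    case 1
    have le: "\<phi> t \<le> 1/2" if "t \<in> \<I>" for t using mono[of t 1] 1 that by auto
    have "(\<lambda>t\<in>\<I>. 2 * \<phi> (0 + 1 * t) - 0) \<in> increasing_maps"
    proof (rule increasing_affine[OF concat.prems])
      show "2 * \<phi> t - 0 \<in> \<I>" if "t \<in> {0..0 + 1}" for t
        using le[of t] \<phi>(1)[of t] that by auto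
    qed auto
    moreover have "compose \<I> (concat_path \<omega> \<nu>) \<phi> = compose \<I> \<omega> (\<lambda>t\<in>\<I>. 2 * \<phi> (0 + 1 * t) - 0)"
    proof
      fix t show "compose \<I> (concat_path \<omega> \<nu>) \<phi> t = compose \<I> \<omega> (\<lambda>t\<in>\<I>. 2 * \<phi> (0 + 1 * t) - 0) t"
        using \<phi>(1)[of t] le[of t] by (auto simp: compose_def concat_path_def)
    qed
    ultimately show ?thesis using concat.IH(1) by simp
  next
    case 2
    have ge: "1/2 \<le> \<phi> t" if "t \<in> \<I>" for t using mono[of 0 t] 2 that by auto
    have "(\<lambda>t\<in>\<I>. 2 * \<phi> (0 + 1 * t) - 1) \<in> increasing_maps"
      by (rule increasing_affine[OF concat.prems]) (use \<phi>(1) ge in force)+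
    moreover have "compose \<I> (concat_path \<omega> \<nu>) \<phi> =
        compose \<I> \<nu> (\<lambda>t\<in>\<I>. 2 * \<phi> (0 + 1 * t) - 1)"
    proof
      fix t show "compose \<I> (concat_path \<omega> \<nu>) \<phi> t =
        compose \<I> \<nu> (\<lambda>t\<in>\<I>. 2 * \<phi> (0 + 1 * t) - 1) t"
      proof (cases "\<phi> t = 1/2")
        case True then show ?thesis
          using concat.hyps(3) by (simp add: compose_def concat_path_def True)
      next
        case False then show ?thesis using \<phi>(1)[of t] ge[of t]
          by (auto simp: compose_def concat_path_def)
      qed
    qed
    ultimately show ?thesis using concat.IH(2) by simp
  next
    case 3
    obtain c where c: "0 \<le> c" "c \<le> 1" "\<phi> c = 1/2"
      using IVT'[of \<phi> 0 "1/2" 1] 3 \<phi>(3) by auto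
    with 3 have c01: "0 < c" "c < 1" by (auto simp: less_le)
    have le: "\<phi> t \<le> 1/2" if "0 \<le> t" "t \<le> c" for t using mono[of t c] c that by auto
    have ge: "1/2 \<le> \<phi> t" if "c \<le> t" "t \<le> 1" for t using mono[of c t] c that by auto
    let ?\<phi>1 = "\<lambda>t\<in>\<I>. 2 * \<phi> (0 + c * t) - 0"
    let ?\<phi>2 = "\<lambda>t\<in>\<I>. 2 * \<phi> (c + (1 - c) * t) - 1"
    have "?\<phi>1 \<in> increasing_maps"
    proof (rule increasing_affine[OF concat.prems])
      show "2 * \<phi> t - 0 \<in> \<I>" if "t \<in> {0..0 + c}" for t
        using le[of t] \<phi>(1)[of t] that c by auto
    qed (use c in auto)
    from concat.IH(1)[OF this] obtain \<omega>' \<psi> where 1: "\<omega>' \<in> cube_path_concats P"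
      "\<psi> \<in> increasing_maps" "\<psi> 0 = 0" "\<psi> 1 = 1" "compose \<I> \<omega> ?\<phi>1 = compose \<I> \<omega>' \<psi>" by blast
    have "?\<phi>2 \<in> increasing_maps"
      by (rule increasing_affine[OF concat.prems]) (use \<phi>(1) ge c in force)+
    from concat.IH(2)[OF this] obtain \<nu>' \<xi> where 2: "\<nu>' \<in> cube_path_concats P"
      "\<xi> \<in> increasing_maps" "\<xi> 0 = 0" "\<xi> 1 = 1" "compose \<I> \<nu> ?\<phi>2 = compose \<I> \<nu>' \<xi>" by blast
    have e: "\<omega> (2 * \<phi> (c * t)) = \<omega>' (\<psi> t)" "\<nu> (2 * \<phi> (c + (1 - c) * t) - 1) = \<nu>' (\<xi> t)"
      if "t \<in> \<I>" for t
      using fun_cong[OF 1(5), of t] fun_cong[OF 2(5), of t] that by (auto simp: compose_def)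
    have j: "\<omega>' 1 = \<nu>' 0"
      using e(1)[of 1] e(2)[of 0] 1 2 c concat.hyps by auto
    let ?\<rho> = "\<lambda>t\<in>\<I>. if t \<le> c then \<psi> (t / c) / 2 else (1 + \<xi> ((t - c) / (1 - c))) / 2"
    have "?\<rho> \<in> increasing_maps" using increasing_paste 1 2 c01 by blast
    moreover have "concat_path \<omega>' \<nu>' \<in> cube_path_concats P"
      using cube_path_concats.concat 1 2 j by blast
    moreover have "?\<rho> 0 = 0" "?\<rho> 1 = 1" using 1 2 c01 by auto
    moreover have "compose \<I> (concat_path \<omega> \<nu>) \<phi> = compose \<I> (concat_path \<omega>' \<nu>') ?\<rho>"
    proof -
      have "compose \<I> (concat_path \<omega> \<nu>) \<phi> t =
        (\<lambda>t\<in>\<I>. if t \<le> c then \<omega>' (\<psi> (t / c)) else \<nu>' (\<xi> ((t - c) / (1 - c)))) t" for t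
      proof -
        consider "t \<notin> \<I>" | "t \<in> \<I>" "t \<le> c" | "t \<in> \<I>" "c < t" by linarith
        then show ?thesis
        proof cases
          case 2
          then show ?thesis using e(1)[of "t / c"] le[of t] \<phi>(1)[of t] c01
            by (auto simp: compose_def concat_path_def)
        next
          case 3
          then have u: "(t - c) / (1 - c) \<in> \<I>" using c01 by auto
          have "c + (1 - c) * ((t - c) / (1 - c)) = t" using c01 by simp
          then have "\<nu> (2 * \<phi> t - 1) = \<nu>' (\<xi> ((t - c) / (1 - c)))"
            using e(2)[OF u] by metis
          moreover have "concat_path \<omega> \<nu> (\<phi> t) = \<nu> (2 * \<phi> t - 1)"
          proof (cases "\<phi> t = 1/2")
            case True then show ?thesis
              using concat.hyps(3) by (simp add: concat_path_def True)
          next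
            case False then show ?thesis
              using ge[of t] \<phi>(1)[of t] 3 by (auto simp: concat_path_def)
          qed
          ultimately show ?thesis using 3 by (simp add: compose_def)
        qed (auto simp: compose_def)
      qed
      then show ?thesis
        using compose_concat_paste[OF 1(2) 2(2) c01 1(4) 2(3), of \<omega>' \<nu>'] j by auto
    qed
    ultimately show ?thesis by (intro bexI conjI)
  qed
qed

lemma d_space_realization: "d_space (realization P)"
  unfolding d_space_def
proof (intro conjI ballI impI)
  show "dpaths (realization P) \<subseteq> paths (dtop (realization P))"
    using compose_paths cube_path_concats_paths by (fastforce simp: realization_def)
next
  fix a assume "a \<in> dpoints (realization P)"
  then have "a \<in> rclass P ` topspace (cube_sum P)"
    using quotient_imp_surjective_map[OF quotient_map_rclass] by (auto simp: realization_def)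
  then obtain n x u where x: "x \<in> cells P n" "u \<in> topspace (cube n)" "a = rclass P ((n, x), u)"
    by (auto simp: cube_sum_def)
  have "continuous_map (top_of_set \<I>) (cube n) (\<lambda>t\<in>\<I>. u)"
    by (rule continuous_map_eq[of _ _ "\<lambda>_. u"]) (use x in auto)
  then have "(\<lambda>t\<in>\<I>. u) \<in> paths (cube n)"
    unfolding paths_def pathin_def by (simp del: restrict_apply)
  then have "(\<lambda>t\<in>\<I>. rclass P ((n, x), (\<lambda>t\<in>\<I>. u) t)) \<in> cube_path_concats P"
    by (rule cube_path_concats.cube_path[OF x(1)]) auto
  moreover note restrict_id_increasing
  moreover have "(\<lambda>t\<in>\<I>. a) =
      compose \<I> (\<lambda>t\<in>\<I>. rclass P ((n, x), (\<lambda>t\<in>\<I>. u) t)) (\<lambda>t\<in>\<I>. t)"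
    by (rule ext) (simp add: compose_def x(3))
  ultimately show "(\<lambda>t\<in>\<I>. a) \<in> dpaths (realization P)"
    unfolding realization_def by auto
next
  fix \<omega> \<phi> assume "\<omega> \<in> dpaths (realization P)" and \<phi>: "\<phi> \<in> increasing_maps"
  then obtain \<nu> \<psi> where \<nu>: "\<nu> \<in> cube_path_concats P" "\<psi> \<in> increasing_maps" "\<omega> = compose \<I> \<nu> \<psi>"
    by (auto simp: realization_def)
  have "compose \<I> \<psi> \<phi> \<in> paths (top_of_set \<I>)"
    using \<nu>(2) by (intro compose_paths \<phi>) (simp add: increasing_maps_def)
  moreover have "mono_on \<I> (compose \<I> \<psi> \<phi>)"
  proof (rule mono_onI)
    fix r s :: real assume rs: "r \<in> \<I>" "s \<in> \<I>" "r \<le> s"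
    then have "\<phi> r \<in> \<I>" "\<phi> s \<in> \<I>"
      using \<phi> by (auto simp: increasing_maps_iff image_subset_iff)
    moreover have "\<phi> r \<le> \<phi> s"
      by (rule mono_onD[of \<I> \<phi>]) (use \<phi> rs in \<open>simp_all add: increasing_maps_iff\<close>)
    moreover have "mono_on \<I> \<psi>" using \<nu>(2) by (simp add: increasing_maps_iff)
    ultimately show "compose \<I> \<psi> \<phi> r \<le> compose \<I> \<psi> \<phi> s"
      using rs by (simp add: compose_def mono_onD)
  qed
  ultimately have "compose \<I> \<psi> \<phi> \<in> increasing_maps"
    by (simp add: increasing_maps_def)
  moreover have "compose \<I> \<omega> \<phi> = compose \<I> \<nu> (compose \<I> \<psi> \<phi>)"
    using \<phi> \<nu> by (auto simp: compose_def fun_eq_iff increasing_maps_iff image_subset_iff)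
  ultimately show "compose \<I> \<omega> \<phi> \<in> dpaths (realization P)"
    using \<nu> by (auto simp: realization_def)
next
  fix \<omega> \<nu> assume "\<omega> \<in> dpaths (realization P)" "\<nu> \<in> dpaths (realization P)" and eq: "\<omega> 1 = \<nu> 0"
  then obtain \<omega>' \<psi> \<nu>' \<xi> where
    1: "\<omega>' \<in> cube_path_concats P" "\<psi> \<in> increasing_maps" "\<psi> 1 = 1" "\<omega> = compose \<I> \<omega>' \<psi>" and
    2: "\<nu>' \<in> cube_path_concats P" "\<xi> \<in> increasing_maps" "\<xi> 0 = 0" "\<nu> = compose \<I> \<nu>' \<xi>"
    using cube_path_concats_normalize[of _ P] by (simp add: realization_def) metis
  have j: "\<omega>' 1 = \<nu>' 0" using eq 1 2 by (simp add: compose_def)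
  have "concat_path \<omega> \<nu> t = (\<lambda>t\<in>\<I>. if t \<le> 1/2 then \<omega>' (\<psi> (t / (1/2)))
      else \<nu>' (\<xi> ((t - 1/2) / (1 - 1/2)))) t" for t
    using 1 2 by (auto simp: concat_path_def compose_def diff_divide_distrib mult.commute)
  then have "concat_path \<omega> \<nu> = compose \<I> (concat_path \<omega>' \<nu>')
      (\<lambda>t\<in>\<I>. if t \<le> 1/2 then \<psi> (t / (1/2)) / 2 else (1 + \<xi> ((t - 1/2) / (1 - 1/2))) / 2)"
    using compose_concat_paste[OF 1(2) 2(2) _ _ 1(3) 2(3), of "1/2" \<omega>' \<nu>'] j by (simp add: fun_eq_iff)
  then show "concat_path \<omega> \<nu> \<in> dpaths (realization P)"
    using increasing_paste[OF 1(2) 2(2) _ _ 1(3) 2(3), of "1/2"]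
      cube_path_concats.concat[OF 1(1) 2(1) j] by (auto simp: realization_def)
qed

lemma realization_incl_rclass:
  assumes "precubical_subset R P"
  shows "realization_incl P (rclass R p) = rclass P p"
proof -
  have sub: "x \<in> cells P n" if "x \<in> cells R n" for x n
    using assms that by (auto simp: precubical_subset_def)
  have face: "face R (n + 1) i k x = face P (n + 1) i k x"
    if "x \<in> cells R (n + 1)" "i \<in> {1..n + 1}" "k \<in> {0, 1}" for n i k x
  proof -
    have "\<forall>n\<ge>1. \<forall>i\<in>{1..n}. \<forall>k\<in>{0,1}. \<forall>x\<in>cells R n. face R n i k x = face P n i k x"
      using assms unfolding precubical_subset_def by (elim conjE)
    moreover have "1 \<le> n + 1" by simp
    ultimately show ?thesis using that by blast
  qed
  have "glue R \<le> glue P"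
  proof (intro predicate2I)
    fix p q assume "glue R p q"
    then obtain n x u i k where *: "x \<in> cells R (n + 1)" "u \<in> topspace (cube n)"
        "i \<in> {1..n + 1}" "k \<in> {0, 1}" and
      pq: "p = ((n, face R (n + 1) i k x), u)" "q = ((n + 1, x), cube_face n i k u)"
      unfolding glue_def by blast
    from pq(1) have "p = ((n, face P (n + 1) i k x), u)"
      using face[OF *(1,3,4)] by simp
    with pq(2) * sub[OF *(1)] show "glue P p q"
      unfolding glue_def by blast
  qed
  then have "symclp (glue R) \<le> symclp (glue P)"
    by (auto simp: symclp_def le_fun_def)
  from rtranclp_mono[OF this] have 1: "equivclp (glue P) p q" if "equivclp (glue R) p q" for q
    using that unfolding equivclp_def by (rule predicate2D)
  have 2: "rclass P q = rclass P p" if "q \<in> rclass R p" for q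
  proof -
    have pq: "equivclp (glue P) p q" using 1 that by (simp add: rclass_def)
    have "equivclp (glue P) q r \<longleftrightarrow> equivclp (glue P) p r" for r
      using equivclp_trans[OF pq, of r] equivclp_trans[OF equivclp_sym[OF pq], of r] by argo
    then show ?thesis by (simp add: rclass_def)
  qed
  have "p \<in> rclass R p" by (simp add: rclass_def equivclp_def)
  then show ?thesis
    unfolding realization_incl_def using 2 by fast
qed


section \<open>Categories and the fundamental bipartite graph\<close>

text \<open>The composite of \<open>c \<in> Hom C x y\<close> and \<open>d \<in> Hom C y z\<close> is \<open>Cmp C c d\<close>.\<close>

record ('o, 'm) cat =
  Obj :: "'o set"
  Hom :: "'o \<Rightarrow> 'o \<Rightarrow> 'm set"
  Idt :: "'o \<Rightarrow> 'm"
  Cmp :: "'m \<Rightarrow> 'm \<Rightarrow> 'm"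

record ('o, 'm, 'p, 'n) functor_data =
  on_obj :: "'o \<Rightarrow> 'p"
  on_mor :: "'m \<Rightarrow> 'n"

text \<open>Only the values of \<open>F\<close> on objects and morphisms of \<open>C\<close> matter, so a functor and its
  restriction to a subcategory are given by the same data.\<close>

definition is_functor ::
    "('o, 'm) cat \<Rightarrow> ('p, 'n) cat \<Rightarrow> ('o, 'm, 'p, 'n) functor_data \<Rightarrow> bool" where
  "is_functor C D F \<longleftrightarrow>
     (\<forall>x\<in>Obj C. on_obj F x \<in> Obj D) \<and>
     (\<forall>x\<in>Obj C. \<forall>y\<in>Obj C. \<forall>c\<in>Hom C x y. on_mor F c \<in> Hom D (on_obj F x) (on_obj F y)) \<and>
     (\<forall>x\<in>Obj C. on_mor F (Idt C x) = Idt D (on_obj F x)) \<and>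
     (\<forall>x\<in>Obj C. \<forall>y\<in>Obj C. \<forall>z\<in>Obj C. \<forall>c\<in>Hom C x y. \<forall>d\<in>Hom C y z.
        on_mor F (Cmp C c d) = Cmp D (on_mor F c) (on_mor F d))"

definition is_isomorphism ::
    "('o, 'm) cat \<Rightarrow> ('p, 'n) cat \<Rightarrow> ('o, 'm, 'p, 'n) functor_data \<Rightarrow> bool" where
  "is_isomorphism C D F \<longleftrightarrow> is_functor C D F \<and>
     (\<exists>G. is_functor D C G \<and>
        (\<forall>x\<in>Obj C. on_obj G (on_obj F x) = x) \<and>
        (\<forall>x\<in>Obj C. \<forall>y\<in>Obj C. \<forall>c\<in>Hom C x y. on_mor G (on_mor F c) = c) \<and>
        (\<forall>x\<in>Obj D. on_obj F (on_obj G x) = x) \<and>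
        (\<forall>x\<in>Obj D. \<forall>y\<in>Obj D. \<forall>c\<in>Hom D x y. on_mor F (on_mor G c) = c))"

definition full_subcat :: "('o, 'm) cat \<Rightarrow> 'o set \<Rightarrow> ('o, 'm) cat" where
  "full_subcat C S = C\<lparr>Obj := Obj C \<inter> S\<rparr>"

text \<open>Dihomotopy relative to \<open>{0,1}\<close> of d-paths is that of d-maps from the directed interval.\<close>

definition dpath_class :: "'b dspace \<Rightarrow> (real \<Rightarrow> 'b) \<Rightarrow> (real \<Rightarrow> 'b) set" where
  "dpath_class X \<omega> = {\<nu> \<in> dpaths X. dihomotopic_rel {0, 1} directed_interval X \<omega> \<nu>}"

text \<open>The composite of two classes is the union of the (equal) classes of the concatenations of
  representatives; \<open>pi1_functor\<close> is defined in the same way.\<close>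

definition pi1 :: "'b dspace \<Rightarrow> ('b, (real \<Rightarrow> 'b) set) cat" where
  "pi1 X = \<lparr>Obj = dpoints X,
     Hom = (\<lambda>a b. dpath_class X ` {\<omega> \<in> dpaths X. \<omega> 0 = a \<and> \<omega> 1 = b}),
     Idt = (\<lambda>a. dpath_class X (\<lambda>t\<in>\<I>. a)),
     Cmp = (\<lambda>c d. \<Union>\<omega>\<in>c. \<Union>\<nu>\<in>d. dpath_class X (concat_path \<omega> \<nu>))\<rparr>"

definition pi1_functor ::
    "'c dspace \<Rightarrow> ('b \<Rightarrow> 'c) \<Rightarrow> ('b, (real \<Rightarrow> 'b) set, 'c, (real \<Rightarrow> 'c) set) functor_data" where
  "pi1_functor Y f = \<lparr>on_obj = f, on_mor = (\<lambda>c. \<Union>\<omega>\<in>c. dpath_class Y (compose \<I> f \<omega>))\<rparr>"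

definition minimal_point :: "'b dspace \<Rightarrow> 'b \<Rightarrow> bool" where
  "minimal_point X a \<longleftrightarrow> a \<in> dpoints X \<and>
     (\<forall>x\<in>Obj (pi1 X). \<forall>c\<in>Hom (pi1 X) x a. x = a)"

definition maximal_point :: "'b dspace \<Rightarrow> 'b \<Rightarrow> bool" where
  "maximal_point X a \<longleftrightarrow> a \<in> dpoints X \<and>
     (\<forall>x\<in>Obj (pi1 X). \<forall>c\<in>Hom (pi1 X) a x. x = a)"

definition extremal_points :: "'b dspace \<Rightarrow> 'b set" where
  "extremal_points X = {a. minimal_point X a \<or> maximal_point X a}"

definition bipartite_graph :: "'b dspace \<Rightarrow> ('b, (real \<Rightarrow> 'b) set) cat" where
  "bipartite_graph X = full_subcat (pi1 X) (extremal_points X)"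

end

theory Submission
  imports Defs
begin

text \<open>
  Extremal points of \<open>|P|\<close> are vertices (dually for maximal ones): a minimal point \<open>[x,u]\<close> is the end of the
  straight d-path from \<open>[x,(0,\<dots>,0)]\<close>, hence equals this vertex, which is then minimal in \<open>P\<close>. For the
  converse, the representatives \<open>(x,u)\<close> of a minimal vertex all have \<open>u = (0,\<dots>,0)\<close>, because
  the gluing relation preserves this property as long as no edge ends at the vertex, so a d-path
  ending there is constant in each cube it meets. Thus the extremal points of \<open>|P|\<close> and \<open>|Q|\<close>
  are exactly the points of the common d-subspace that \<open>f\<close>, its inverse \<open>g\<close> and the dihomotopies
  fix. A dihomotopy \<open>g \<circ> f \<simeq> id\<close> relative to these points turns, by composition with d-paths between
  them, into a dihomotopy of d-paths with fixed end points, and, by continuity of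
  \<open>(t,\<omega>) \<mapsto> H(t,\<omega>(-))\<close> in the compact-open topology, into a homotopy on the d-path space.
\<close>

section \<open>d-maps\<close>

lemma d_space_dpaths:
  assumes "d_space X" "\<omega> \<in> dpaths X"
  shows "\<omega> \<in> paths (dtop X)" "\<omega> \<in> extensional \<I>" "\<omega> \<in> \<I> \<rightarrow> dpoints X"
    "continuous_map (top_of_set \<I>) (dtop X) \<omega>"
proof -
  show p: "\<omega> \<in> paths (dtop X)" using assms by (auto simp: d_space_def)
  then show "\<omega> \<in> extensional \<I>" "continuous_map (top_of_set \<I>) (dtop X) \<omega>"
    by (auto simp: paths_def pathin_def)
  then show "\<omega> \<in> \<I> \<rightarrow> dpoints X" using continuous_map_funspace by fastforce
qed

lemma d_space_const: "d_space X \<Longrightarrow> a \<in> dpoints X \<Longrightarrow> (\<lambda>t\<in>\<I>. a) \<in> dpaths X"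
  by (simp add: d_space_def)

lemma d_space_concat:
  "d_space X \<Longrightarrow> \<omega> \<in> dpaths X \<Longrightarrow> \<nu> \<in> dpaths X \<Longrightarrow> \<omega> 1 = \<nu> 0 \<Longrightarrow> concat_path \<omega> \<nu> \<in> dpaths X"
  by (simp add: d_space_def)

lemma d_map_dpaths: "d_map X Y f \<Longrightarrow> \<omega> \<in> dpaths X \<Longrightarrow> compose \<I> f \<omega> \<in> dpaths Y"
  by (simp add: d_map_def)

lemma d_map_dpoints: "d_map X Y f \<Longrightarrow> a \<in> dpoints X \<Longrightarrow> f a \<in> dpoints Y"
  using continuous_map_funspace by (fastforce simp: d_map_def)

lemma compose_unit_interval_comp: "compose \<I> (f \<circ> g) \<omega> = compose \<I> f (compose \<I> g \<omega>)"
  by (auto simp: compose_def fun_eq_iff)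

lemma concat_path_ends [simp]: "concat_path \<omega> \<nu> 0 = \<omega> 0" "concat_path \<omega> \<nu> 1 = \<nu> 1"
  by (simp_all add: concat_path_def)

lemma compose_concat_path:
  "compose \<I> f (concat_path \<omega> \<nu>) = concat_path (compose \<I> f \<omega>) (compose \<I> f \<nu>)"
  by (auto simp: compose_def concat_path_def fun_eq_iff)

lemma d_map_comp: "d_map X Y f \<Longrightarrow> d_map Y Z g \<Longrightarrow> d_map X Z (g \<circ> f)"
  unfolding d_map_def compose_unit_interval_comp by (blast intro: continuous_map_compose)

text \<open>\<open>homotopic_with\<close> unfolds into an explicit homotopy only for properties that
  depend on values at points of the space. D-paths stay among these points, so being a d-map
  qualifies.\<close>

lemma d_map_cong:
  assumes "d_space X" "\<And>x. x \<in> dpoints X \<Longrightarrow> f x = g x"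
  shows "d_map X Y f \<longleftrightarrow> d_map X Y g"
proof -
  have "compose \<I> f \<omega> = compose \<I> g \<omega>" if "\<omega> \<in> dpaths X" for \<omega>
  proof -
    have "f (\<omega> t) = g (\<omega> t)" if "t \<in> \<I>" for t
      using assms(2) Pi_mem[OF d_space_dpaths(3)[OF assms(1) \<open>\<omega> \<in> dpaths X\<close>] that] .
    then show ?thesis by (simp add: compose_def fun_eq_iff)
  qed
  moreover have "continuous_map (dtop X) (dtop Y) f \<longleftrightarrow> continuous_map (dtop X) (dtop Y) g"
    using assms(2) by (auto intro: continuous_map_eq)
  ultimately show ?thesis by (auto simp: d_map_def)
qed

lemma d_space_directed_interval: "d_space directed_interval"
  unfolding d_space_def
proof (intro conjI ballI impI)
  show "dpaths directed_interval \<subseteq> paths (dtop directed_interval)"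
    by (auto simp: directed_interval_def increasing_maps_def)
next
  fix a assume "a \<in> dpoints directed_interval"
  then show "(\<lambda>t\<in>\<I>. a) \<in> dpaths directed_interval"
    by (auto simp: directed_interval_def continuous_on_restrict_iff[unfolded restrict_def]
        intro!: increasing_mapsI simp del: atLeastAtMost_iff) auto
next
  fix \<omega> \<phi> assume "\<omega> \<in> dpaths directed_interval" and \<phi>: "\<phi> \<in> increasing_maps"
  then have \<omega>: "\<omega> \<in> increasing_maps" by (simp add: directed_interval_def)
  then have "compose \<I> \<omega> \<phi> \<in> paths (top_of_set \<I>)"
    by (intro compose_paths \<phi>) (simp add: increasing_maps_def)
  moreover have "mono_on \<I> (compose \<I> \<omega> \<phi>)"
    using \<omega> \<phi> by (fastforce simp: increasing_maps_iff mono_on_def compose_def image_subset_iff)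
  ultimately show "compose \<I> \<omega> \<phi> \<in> dpaths directed_interval"
    by (simp add: directed_interval_def increasing_maps_def)
next
  fix \<omega> \<nu> assume "\<omega> \<in> dpaths directed_interval" "\<nu> \<in> dpaths directed_interval" "\<omega> 1 = \<nu> 0"
  then have inc: "\<omega> \<in> increasing_maps" "\<nu> \<in> increasing_maps" and eq: "\<omega> 1 = \<nu> 0"
    by (auto simp: directed_interval_def)
  then have "concat_path \<omega> \<nu> \<in> paths (top_of_set \<I>)"
    by (intro concat_path_paths) (auto simp: increasing_maps_def)
  moreover have "mono_on \<I> (concat_path \<omega> \<nu>)"
  proof (rule mono_onI)
    fix r s :: real assume rs: "r \<in> \<I>" "s \<in> \<I>" "r \<le> s"
    have m: "\<omega> a \<le> \<omega> b" "\<nu> a \<le> \<nu> b" if "0 \<le> a" "a \<le> b" "b \<le> 1" for a b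
      using inc that by (auto simp: increasing_maps_iff mono_on_def)
    consider "s \<le> 1/2" | "r \<le> 1/2" "1/2 < s" | "1/2 < r" by linarith
    then show "concat_path \<omega> \<nu> r \<le> concat_path \<omega> \<nu> s"
    proof cases
      case 2
      then show ?thesis
        using m(1)[of "2 * r" 1] m(2)[of 0 "2 * s - 1"] eq rs by (auto simp: concat_path_def)
    qed (use rs m in \<open>auto simp: concat_path_def\<close>)
  qed
  ultimately show "concat_path \<omega> \<nu> \<in> dpaths directed_interval"
    by (simp add: directed_interval_def increasing_maps_def)
qed

lemma dtop_directed_interval [simp]: "dtop directed_interval = top_of_set \<I>"
  by (simp add: directed_interval_def)

text \<open>Forward, \<open>h\<close> is applied to the identity path; backward, d-paths are closed
  under increasing reparametrization. The restriction is there because paths are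
  \<open>undefined\<close> outside the interval.\<close>

lemma d_map_directed_interval_iff:
  assumes "d_space X"
  shows "d_map directed_interval X h \<longleftrightarrow> restrict h \<I> \<in> dpaths X"
proof
  assume "d_map directed_interval X h"
  from d_map_dpaths[OF this, of "\<lambda>t\<in>\<I>. t"] restrict_id_increasing
  have "compose \<I> h (\<lambda>t\<in>\<I>. t) \<in> dpaths X" by (simp add: directed_interval_def)
  moreover have "compose \<I> h (\<lambda>t\<in>\<I>. t) = restrict h \<I>" by (auto simp: compose_def)
  ultimately show "restrict h \<I> \<in> dpaths X" by simp
next
  assume *: "restrict h \<I> \<in> dpaths X"
  have "compose \<I> h \<phi> \<in> dpaths X" if "\<phi> \<in> increasing_maps" for \<phi>
  proof -
    have "compose \<I> (restrict h \<I>) \<phi> \<in> dpaths X"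
      using assms * that by (simp add: d_space_def)
    moreover have "compose \<I> (restrict h \<I>) \<phi> = compose \<I> h \<phi>"
      using that by (auto simp: compose_def increasing_maps_iff fun_eq_iff image_subset_iff)
    ultimately show ?thesis by simp
  qed
  moreover have "continuous_map (top_of_set \<I>) (dtop X) h"
    by (rule continuous_map_eq[OF d_space_dpaths(4)[OF assms *]]) simp
  ultimately show "d_map directed_interval X h"
    by (simp add: d_map_def directed_interval_def)
qed

lemma dpath_d_map: "d_space X \<Longrightarrow> \<omega> \<in> dpaths X \<Longrightarrow> d_map directed_interval X \<omega>"
  using d_map_directed_interval_iff[of X \<omega>] d_space_dpaths(2)[of X \<omega>]
  by (simp add: extensional_restrict)


section \<open>Relative dihomotopy\<close>

lemma dihomotopic_rel_iff:
  assumes "d_space X" "A \<subseteq> dpoints X"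
  shows "dihomotopic_rel A X Y f g \<longleftrightarrow>
    (\<exists>h. continuous_map (prod_topology (top_of_set \<I>) (dtop X)) (dtop Y) h \<and>
         (\<forall>x\<in>dpoints X. h (0, x) = f x) \<and> (\<forall>x\<in>dpoints X. h (1, x) = g x) \<and>
         (\<forall>t\<in>\<I>. d_map X Y (\<lambda>x. h (t, x)) \<and> (\<forall>a\<in>A. h (t, a) = f a \<and> h (t, a) = g a)))"
  unfolding dihomotopic_rel_def
proof (rule homotopic_with)
  fix h k :: "'a \<Rightarrow> 'b" assume eq: "\<And>x. x \<in> dpoints X \<Longrightarrow> h x = k x"
  then have "\<forall>a\<in>A. h a = k a" using assms by blast
  then show "(d_map X Y h \<and> (\<forall>a\<in>A. h a = f a \<and> h a = g a)) \<longleftrightarrow>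
      (d_map X Y k \<and> (\<forall>a\<in>A. k a = f a \<and> k a = g a))"
    using d_map_cong[where f = h and g = k and Y = Y, OF assms(1) eq] by auto
qed

text \<open>Splitting off the agreement on \<open>A\<close> leaves a condition on the intermediate
  maps that mentions only \<open>f\<close>. For transitivity, the homotopies from \<open>f\<close>
  to \<open>g\<close> and from \<open>g\<close> to \<open>h\<close> then run through the same class
  of maps.\<close>

lemma dihomotopic_rel_alt:
  "dihomotopic_rel A X Y f g \<longleftrightarrow> (\<forall>a\<in>A. f a = g a) \<and>
     homotopic_with (\<lambda>h. d_map X Y h \<and> (\<forall>a\<in>A. h a = f a)) (dtop X) (dtop Y) f g"
proof -
  have "\<forall>a\<in>A. f a = g a" if "dihomotopic_rel A X Y f g"
    using homotopic_with_imp_property[OF that[unfolded dihomotopic_rel_def]] by blast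
  moreover have "(\<lambda>h. d_map X Y h \<and> (\<forall>a\<in>A. h a = f a \<and> h a = g a)) =
      (\<lambda>h. d_map X Y h \<and> (\<forall>a\<in>A. h a = f a))" if "\<forall>a\<in>A. f a = g a"
    using that by fastforce
  ultimately show ?thesis
    unfolding dihomotopic_rel_def by (cases "\<forall>a\<in>A. f a = g a") (simp, blast)
qed

lemma dihomotopic_rel_refl: "d_map X Y f \<Longrightarrow> dihomotopic_rel A X Y f f"
  by (simp add: dihomotopic_rel_def d_map_def)

lemma dihomotopic_rel_sym: "dihomotopic_rel A X Y f g \<Longrightarrow> dihomotopic_rel A X Y g f"
  unfolding dihomotopic_rel_def by (drule homotopic_with_symD) (erule homotopic_with_mono, blast)

lemma dihomotopic_rel_trans:
  assumes "dihomotopic_rel A X Y f g" "dihomotopic_rel A X Y g h"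
  shows "dihomotopic_rel A X Y f h"
proof -
  have eq: "\<forall>a\<in>A. f a = g a" "\<forall>a\<in>A. g a = h a"
    using assms by (auto simp: dihomotopic_rel_alt)
  then have "(\<lambda>k. d_map X Y k \<and> (\<forall>a\<in>A. k a = g a)) = (\<lambda>k. d_map X Y k \<and> (\<forall>a\<in>A. k a = f a))"
    by fastforce
  then show ?thesis
    using assms eq unfolding dihomotopic_rel_alt by (auto intro: homotopic_with_trans)
qed

lemma dihomotopic_rel_compose_left:
  assumes "dihomotopic_rel A X Y f g" "d_map Y Z k"
  shows "dihomotopic_rel A X Z (k \<circ> f) (k \<circ> g)"
  using assms(1) unfolding dihomotopic_rel_def
proof (rule homotopic_with_compose_continuous_map_left)
  show "continuous_map (dtop Y) (dtop Z) k" using assms(2) by (simp add: d_map_def)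
qed (simp add: d_map_comp[OF _ assms(2)], metis)

lemma dihomotopic_rel_compose_right:
  assumes "dihomotopic_rel B Y Z f g" "d_map X Y k" "k ` A \<subseteq> B"
  shows "dihomotopic_rel A X Z (f \<circ> k) (g \<circ> k)"
  using assms(1) unfolding dihomotopic_rel_def
proof (rule homotopic_with_compose_continuous_map_right)
  show "continuous_map (dtop X) (dtop Y) k" using assms(2) by (simp add: d_map_def)
qed (use assms(3) in \<open>simp add: d_map_comp[OF assms(2)] image_subset_iff, metis\<close>)

text \<open>Used to pass between \<open>f \<circ> \<omega>\<close> and
  \<open>compose \<I> f \<omega>\<close>, which agree on the interval but may differ outside
  it.\<close>

lemma dihomotopic_rel_cong:
  assumes "d_space X" "A \<subseteq> dpoints X"
    and "\<And>x. x \<in> dpoints X \<Longrightarrow> f x = f' x" "\<And>x. x \<in> dpoints X \<Longrightarrow> g x = g' x"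
  shows "dihomotopic_rel A X Y f g \<longleftrightarrow> dihomotopic_rel A X Y f' g'"
proof -
  have "(\<forall>a\<in>A. h a = f a \<and> h a = g a) \<longleftrightarrow> (\<forall>a\<in>A. h a = f' a \<and> h a = g' a)" for h
    using assms by (metis subsetD)
  then show ?thesis
    unfolding dihomotopic_rel_iff[OF assms(1,2)] using assms(3,4) by simp
qed

section \<open>Dihomotopy of d-paths with fixed end points\<close>

abbreviation dihomotopic_paths :: "'b dspace \<Rightarrow> (real \<Rightarrow> 'b) \<Rightarrow> (real \<Rightarrow> 'b) \<Rightarrow> bool" where
  "dihomotopic_paths X \<equiv> dihomotopic_rel {0, 1} directed_interval X"

lemma dihomotopic_paths_ends:
  "dihomotopic_paths X \<omega> \<nu> \<Longrightarrow> \<omega> 0 = \<nu> 0 \<and> \<omega> 1 = \<nu> 1"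
  by (simp add: dihomotopic_rel_alt)

lemma dihomotopic_paths_iff:
  assumes "d_space X"
  shows "dihomotopic_paths X \<omega> \<nu> \<longleftrightarrow>
    (\<exists>h. continuous_map (prod_topology (top_of_set \<I>) (top_of_set \<I>)) (dtop X) h \<and>
         (\<forall>s\<in>\<I>. h (0, s) = \<omega> s) \<and> (\<forall>s\<in>\<I>. h (1, s) = \<nu> s) \<and>
         (\<forall>t\<in>\<I>. (\<lambda>s\<in>\<I>. h (t, s)) \<in> dpaths X \<and>
            h (t, 0) = \<omega> 0 \<and> h (t, 0) = \<nu> 0 \<and> h (t, 1) = \<omega> 1 \<and> h (t, 1) = \<nu> 1))"
  by (subst dihomotopic_rel_iff)
    (simp_all add: d_space_directed_interval d_map_directed_interval_iff[OF assms])

text \<open>Both dihomotopies keep the common middle point fixed, so they can be pasted along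
  \<open>snd p = 1/2\<close>. Each slice of the result is a concatenation of two slices, hence a
  d-path.\<close>

lemma dihomotopic_paths_concat:
  assumes X: "d_space X" and "dihomotopic_paths X \<omega> \<omega>'" "dihomotopic_paths X \<nu> \<nu>'"
    and eq: "\<omega> 1 = \<nu> 0"
  shows "dihomotopic_paths X (concat_path \<omega> \<nu>) (concat_path \<omega>' \<nu>')"
proof -
  let ?II = "prod_topology (top_of_set \<I>) (top_of_set \<I>) :: (real \<times> real) topology"
  obtain h where h: "continuous_map ?II (dtop X) h"
    "\<And>s. s \<in> \<I> \<Longrightarrow> h (0, s) = \<omega> s" "\<And>s. s \<in> \<I> \<Longrightarrow> h (1, s) = \<omega>' s"
    "\<And>t. t \<in> \<I> \<Longrightarrow> (\<lambda>s\<in>\<I>. h (t, s)) \<in> dpaths X \<and>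
       h (t, 0) = \<omega> 0 \<and> h (t, 0) = \<omega>' 0 \<and> h (t, 1) = \<omega> 1 \<and> h (t, 1) = \<omega>' 1"
    using assms(2) unfolding dihomotopic_paths_iff[OF X] by blast
  obtain k where k: "continuous_map ?II (dtop X) k"
    "\<And>s. s \<in> \<I> \<Longrightarrow> k (0, s) = \<nu> s" "\<And>s. s \<in> \<I> \<Longrightarrow> k (1, s) = \<nu>' s"
    "\<And>t. t \<in> \<I> \<Longrightarrow> (\<lambda>s\<in>\<I>. k (t, s)) \<in> dpaths X \<and>
       k (t, 0) = \<nu> 0 \<and> k (t, 0) = \<nu>' 0 \<and> k (t, 1) = \<nu> 1 \<and> k (t, 1) = \<nu>' 1"
    using assms(3) unfolding dihomotopic_paths_iff[OF X] by blast
  define H where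
    "H = (\<lambda>p. if snd p \<le> 1/2 then h (fst p, 2 * snd p) else k (fst p, 2 * snd p - 1))"
  \<comment> \<open>Seen as a Euclidean square, the product reduces continuity of the two rescalings
    to \<open>continuous_on\<close>.\<close>
  have II: "?II = top_of_set (\<I> \<times> \<I>)"
    by (simp add: subtopology_Times)
  have "continuous_map ?II (dtop X) H"
    unfolding H_def
  proof (rule continuous_map_cases_le)
    show "continuous_map ?II euclideanreal snd" "continuous_map ?II euclideanreal (\<lambda>p. 1/2)"
      by (simp_all add: II continuous_on_snd)
    have "continuous_map (subtopology ?II {p \<in> topspace ?II. snd p \<le> 1/2}) ?II
        (\<lambda>p. (fst p, 2 * snd p))"
      unfolding II subtopology_subtopology continuous_map_subtopology_eu
      by (auto intro!: continuous_intros)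
    from continuous_map_compose[OF this h(1)]
    show "continuous_map (subtopology ?II {p \<in> topspace ?II. snd p \<le> 1/2}) (dtop X)
        (\<lambda>p. h (fst p, 2 * snd p))" by (simp only: o_def)
    have "continuous_map (subtopology ?II {p \<in> topspace ?II. 1/2 \<le> snd p}) ?II
        (\<lambda>p. (fst p, 2 * snd p - 1))"
      unfolding II subtopology_subtopology continuous_map_subtopology_eu
      by (auto intro!: continuous_intros)
    from continuous_map_compose[OF this k(1)]
    show "continuous_map (subtopology ?II {p \<in> topspace ?II. 1/2 \<le> snd p}) (dtop X)
        (\<lambda>p. k (fst p, 2 * snd p - 1))" by (simp only: o_def)
    fix p :: "real \<times> real" assume "p \<in> topspace ?II" "snd p = 1/2"
    then have "2 * snd p = 1" "2 * snd p - 1 = 0" "fst p \<in> \<I>" by auto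
    then show "h (fst p, 2 * snd p) = k (fst p, 2 * snd p - 1)"
      using h(4)[of "fst p"] k(4)[of "fst p"] eq by simp
  qed
  moreover have "(\<lambda>s\<in>\<I>. H (t, s)) = concat_path (\<lambda>s\<in>\<I>. h (t, s)) (\<lambda>s\<in>\<I>. k (t, s))" for t
    by (auto simp: H_def concat_path_def fun_eq_iff)
  then have "(\<lambda>s\<in>\<I>. H (t, s)) \<in> dpaths X" if "t \<in> \<I>" for t
    using d_space_concat[OF X] h(4)[OF that] k(4)[OF that] eq by simp
  ultimately show ?thesis
    unfolding dihomotopic_paths_iff[OF X]
    using h k dihomotopic_paths_ends[OF assms(2)] dihomotopic_paths_ends[OF assms(3)]
    by (intro exI[of _ H]) (auto simp: H_def concat_path_def)
qed

lemma dihomotopic_paths_compose: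
  assumes "d_map X Y f" "dihomotopic_paths X \<omega> \<nu>"
  shows "dihomotopic_paths Y (compose \<I> f \<omega>) (compose \<I> f \<nu>)"
  using dihomotopic_rel_compose_left[OF assms(2,1)]
  by (rule dihomotopic_rel_cong[THEN iffD1, rotated -1])
    (auto simp: d_space_directed_interval compose_def)


section \<open>The fundamental category\<close>

lemma on_obj_pi1_functor: "on_obj (pi1_functor Y f) = f"
  by (simp add: pi1_functor_def)

lemma Obj_full_subcat: "Obj (full_subcat C S) = Obj C \<inter> S"
  and Hom_full_subcat: "Hom (full_subcat C S) = Hom C"
  by (simp_all add: full_subcat_def)

lemma dpath_class_self: "d_space X \<Longrightarrow> \<omega> \<in> dpaths X \<Longrightarrow> \<omega> \<in> dpath_class X \<omega>"
  by (simp add: dpath_class_def dihomotopic_rel_refl dpath_d_map)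

lemma dpath_class_eqI: "dihomotopic_paths X \<omega> \<nu> \<Longrightarrow> dpath_class X \<omega> = dpath_class X \<nu>"
  unfolding dpath_class_def using dihomotopic_rel_trans dihomotopic_rel_sym by blast

text \<open>\<open>pi1_functor\<close> acts by a union over representatives. Such a union collapses
  to a single term once dihomotopic representatives contribute the same set, which is
  well-definedness on classes.\<close>

lemma UN_dpath_class:
  assumes "d_space X" "\<omega> \<in> dpaths X"
    and "\<And>\<nu>. \<nu> \<in> dpaths X \<Longrightarrow> dihomotopic_paths X \<omega> \<nu> \<Longrightarrow> F \<nu> = F \<omega>"
  shows "(\<Union>\<nu>\<in>dpath_class X \<omega>. F \<nu>) = F \<omega>"
  using dpath_class_self[OF assms(1,2)] assms(3) unfolding dpath_class_def by blast

lemma pi1_functor_class: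
  assumes "d_space X" "d_map X Y f" "\<omega> \<in> dpaths X"
  shows "on_mor (pi1_functor Y f) (dpath_class X \<omega>) = dpath_class Y (compose \<I> f \<omega>)"
  unfolding pi1_functor_def functor_data.simps
  by (rule UN_dpath_class[OF assms(1,3)])
    (metis dpath_class_eqI dihomotopic_paths_compose[OF assms(2)])

lemma pi1_Cmp_class:
  assumes "d_space X" "\<omega> \<in> dpaths X" "\<nu> \<in> dpaths X" "\<omega> 1 = \<nu> 0"
  shows "Cmp (pi1 X) (dpath_class X \<omega>) (dpath_class X \<nu>) = dpath_class X (concat_path \<omega> \<nu>)"
proof -
  \<comment> \<open>The double union is collapsed one factor at a time, first over the second factor
    with \<open>\<omega>'\<close> fixed.\<close>
  have "(\<Union>\<nu>'\<in>dpath_class X \<nu>. dpath_class X (concat_path \<omega>' \<nu>')) = dpath_class X (concat_path \<omega> \<nu>)"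
    if "\<omega>' \<in> dpaths X" "dihomotopic_paths X \<omega> \<omega>'" for \<omega>'
  proof -
    have "dpath_class X (concat_path \<omega>' \<nu>') = dpath_class X (concat_path \<omega> \<nu>)"
      if "dihomotopic_paths X \<nu> \<nu>'" for \<nu>'
      using dihomotopic_paths_concat[OF assms(1) \<open>dihomotopic_paths X \<omega> \<omega>'\<close> that assms(4)]
        dpath_class_eqI by metis
    then show ?thesis
      using dpath_class_self[OF assms(1,3)] unfolding dpath_class_def by blast
  qed
  then show ?thesis
    using dpath_class_self[OF assms(1,2)] unfolding pi1_def dpath_class_def by simp blast
qed

lemma is_functor_pi1:
  assumes X: "d_space X" and Y: "d_space Y" and f: "d_map X Y f" and ST: "f ` S \<subseteq> T"
  shows "is_functor (full_subcat (pi1 X) S) (full_subcat (pi1 Y) T) (pi1_functor Y f)"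
  unfolding is_functor_def
proof (intro conjI ballI)
  let ?F = "pi1_functor Y f"
  fix x assume "x \<in> Obj (full_subcat (pi1 X) S)"
  then have x: "x \<in> dpoints X" "x \<in> S" by (auto simp: full_subcat_def pi1_def)
  then show "on_obj ?F x \<in> Obj (full_subcat (pi1 Y) T)"
    using d_map_dpoints[OF f] ST by (auto simp: full_subcat_def pi1_def pi1_functor_def)
  have "compose \<I> f (\<lambda>t\<in>\<I>. x) = (\<lambda>t\<in>\<I>. f x)" by (auto simp: compose_def)
  then show "on_mor ?F (Idt (full_subcat (pi1 X) S) x) =
      Idt (full_subcat (pi1 Y) T) (on_obj ?F x)"
    using pi1_functor_class[OF X f d_space_const[OF X x(1)]]
    by (simp add: full_subcat_def pi1_def) (simp add: pi1_functor_def)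
  fix y c assume c: "c \<in> Hom (full_subcat (pi1 X) S) x y"
  then obtain \<omega> where \<omega>: "\<omega> \<in> dpaths X" "\<omega> 0 = x" "\<omega> 1 = y" "c = dpath_class X \<omega>"
    by (auto simp: full_subcat_def pi1_def)
  have "compose \<I> f \<omega> \<in> dpaths Y" "compose \<I> f \<omega> 0 = f x" "compose \<I> f \<omega> 1 = f y"
    using d_map_dpaths[OF f \<omega>(1)] \<omega> by (auto simp: compose_def)
  then show "on_mor ?F c \<in> Hom (full_subcat (pi1 Y) T) (on_obj ?F x) (on_obj ?F y)"
    unfolding \<omega>(4) pi1_functor_class[OF X f \<omega>(1)]
    by (auto simp: full_subcat_def pi1_def pi1_functor_def)
  fix z d assume "d \<in> Hom (full_subcat (pi1 X) S) y z"
  then obtain \<nu> where \<nu>: "\<nu> \<in> dpaths X" "\<nu> 0 = y" "\<nu> 1 = z" "d = dpath_class X \<nu>"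
    by (auto simp: full_subcat_def pi1_def)
  have eq: "\<omega> 1 = \<nu> 0" "compose \<I> f \<omega> 1 = compose \<I> f \<nu> 0"
    using \<omega> \<nu> by (simp_all add: compose_def)
  have "on_mor ?F (Cmp (pi1 X) c d) = Cmp (pi1 Y) (on_mor ?F c) (on_mor ?F d)"
    unfolding \<omega>(4) \<nu>(4) pi1_Cmp_class[OF X \<omega>(1) \<nu>(1) eq(1)] pi1_functor_class[OF X f \<omega>(1)]
      pi1_functor_class[OF X f \<nu>(1)]
      pi1_functor_class[OF X f d_space_concat[OF X \<omega>(1) \<nu>(1) eq(1)]]
      pi1_Cmp_class[OF Y d_map_dpaths[OF f \<omega>(1)] d_map_dpaths[OF f \<nu>(1)] eq(2)]
      compose_concat_path ..
  then show "on_mor ?F (Cmp (full_subcat (pi1 X) S) c d) =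
      Cmp (full_subcat (pi1 Y) T) (on_mor ?F c) (on_mor ?F d)"
    by (simp add: full_subcat_def)
qed

text \<open>Composing the dihomotopy with a d-path whose ends lie in \<open>S\<close> gives a
  dihomotopy of d-paths. It fixes the ends because the given one is relative to
  \<open>S\<close>.\<close>

lemma pi1_functor_inverse:
  assumes X: "d_space X" and Y: "d_space Y" and f: "d_map X Y f" and g: "d_map Y X g"
    and hom: "dihomotopic_rel S X X (g \<circ> f) id"
    and x: "x \<in> S" and y: "y \<in> S" and c: "c \<in> Hom (pi1 X) x y"
  shows "on_mor (pi1_functor X g) (on_mor (pi1_functor Y f) c) = c"
proof -
  obtain \<omega> where \<omega>: "\<omega> \<in> dpaths X" "\<omega> 0 = x" "\<omega> 1 = y" "c = dpath_class X \<omega>"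
    using c by (auto simp: pi1_def)
  have "dihomotopic_paths X ((g \<circ> f) \<circ> \<omega>) (id \<circ> \<omega>)"
    by (rule dihomotopic_rel_compose_right[OF hom dpath_d_map[OF X \<omega>(1)]]) (use \<omega> x y in auto)
  then have "dihomotopic_paths X (compose \<I> (g \<circ> f) \<omega>) \<omega>"
    by (rule dihomotopic_rel_cong[THEN iffD1, rotated -1])
      (auto simp: d_space_directed_interval compose_def)
  then show ?thesis
    unfolding \<omega>(4) pi1_functor_class[OF X f \<omega>(1)]
      pi1_functor_class[OF Y g d_map_dpaths[OF f \<omega>(1)]] compose_unit_interval_comp[symmetric]
    by (rule dpath_class_eqI)
qed

text \<open>Maps that are dihomotopic relative to a set agree on it, so \<open>f\<close> and
  \<open>g\<close> are strictly inverse on the objects \<open>S\<close> and \<open>T\<close>. On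
  morphisms, \<open>pi1_functor_inverse\<close> is used in both directions.\<close>

lemma pi1_full_subcat_isomorphism:
  assumes X: "d_space X" and Y: "d_space Y" and f: "d_map X Y f" and g: "d_map Y X g"
    and fS: "f ` S \<subseteq> T" and gT: "g ` T \<subseteq> S"
    and gf: "dihomotopic_rel S X X (g \<circ> f) id" and fg: "dihomotopic_rel T Y Y (f \<circ> g) id"
  shows "is_isomorphism (full_subcat (pi1 X) S) (full_subcat (pi1 Y) T) (pi1_functor Y f)"
proof -
  have "g (f x) = x" if "x \<in> S" for x using gf that by (simp add: dihomotopic_rel_alt)
  moreover have "f (g y) = y" if "y \<in> T" for y using fg that by (simp add: dihomotopic_rel_alt)
  ultimately show ?thesis
    unfolding is_isomorphism_def
    using is_functor_pi1[OF X Y f fS] is_functor_pi1[OF Y X g gT]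
      pi1_functor_inverse[OF X Y f g gf] pi1_functor_inverse[OF Y X g f fg]
    by (intro conjI exI[of _ "pi1_functor X g"])
      (simp_all add: on_obj_pi1_functor Obj_full_subcat Hom_full_subcat, blast+)
qed


section \<open>Path spaces\<close>

lemma topspace_path_space [simp]: "topspace (path_space T) = paths T"
proof -
  \<comment> \<open>The choice \<open>K = {}\<close>, \<open>U = {}\<close> makes the set of all
    paths a subbasic open set.\<close>
  have "paths T = {\<omega> \<in> paths T. \<omega> ` {} \<subseteq> {}}" by simp
  then show ?thesis unfolding path_space_def topology_generated_by_topspace by fastforce
qed

lemma openin_path_space_basic:
  assumes "compact K" "K \<subseteq> \<I>" "openin T U"
  shows "openin (path_space T) {\<omega> \<in> paths T. \<omega> ` K \<subseteq> U}"
  unfolding path_space_def by (rule topology_generated_by_Basis) (use assms in blast)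

lemma continuous_map_into_path_space:
  assumes "\<And>z. z \<in> topspace Z \<Longrightarrow> F z \<in> paths T"
    and "\<And>K U. \<lbrakk>compact K; K \<subseteq> \<I>; openin T U\<rbrakk> \<Longrightarrow> openin Z {z \<in> topspace Z. F z ` K \<subseteq> U}"
  shows "continuous_map Z (path_space T) F"
  unfolding path_space_def
proof (rule continuous_on_generated_topo)
  show "F ` topspace Z \<subseteq> \<Union>{{\<omega> \<in> paths T. \<omega> ` K \<subseteq> U} |K U. compact K \<and> K \<subseteq> \<I> \<and> openin T U}"
    using assms(1) topspace_path_space[of T]
    unfolding path_space_def topology_generated_by_topspace by blast
  fix V assume "V \<in> {{\<omega> \<in> paths T. \<omega> ` K \<subseteq> U} |K U. compact K \<and> K \<subseteq> \<I> \<and> openin T U}"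
  then obtain K U where KU: "compact K" "K \<subseteq> \<I>" "openin T U" "V = {\<omega> \<in> paths T. \<omega> ` K \<subseteq> U}"
    by blast
  have "F -` V \<inter> topspace Z = {z \<in> topspace Z. F z ` K \<subseteq> U}" using assms(1) KU(4) by blast
  then show "openin Z (F -` V \<inter> topspace Z)" using assms(2)[OF KU(1-3)] by simp
qed

text \<open>A compactness argument: near each \<open>s \<in> K\<close> the condition
  \<open>h (z, \<omega> s) \<in> U\<close> is secured by a product of open sets
  \<open>V \<times> W\<close>, and finitely many such neighbourhoods cover \<open>K\<close>.\<close>

lemma continuous_map_path_space_parametrized:
  assumes h: "continuous_map (prod_topology Z T) T' h"
  shows "continuous_map (prod_topology Z (path_space T)) (path_space T')
           (\<lambda>(z, \<omega>). \<lambda>s\<in>\<I>. h (z, \<omega> s))"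
proof (rule continuous_map_into_path_space)
  fix p assume "p \<in> topspace (prod_topology Z (path_space T))"
  then obtain z \<omega> where p: "p = (z, \<omega>)" "z \<in> topspace Z" "continuous_map (top_of_set \<I>) T \<omega>"
    by (auto simp: paths_def pathin_def)
  have "continuous_map (top_of_set \<I>) (prod_topology Z T) (\<lambda>s. (z, \<omega> s))"
    using p by (simp add: continuous_map_pairedI)
  from continuous_map_compose[OF this h]
  have "continuous_map (top_of_set \<I>) T' (\<lambda>s\<in>\<I>. h (z, \<omega> s))"
    by (rule continuous_map_eq) simp
  then show "(case p of (z, \<omega>) \<Rightarrow> \<lambda>s\<in>\<I>. h (z, \<omega> s)) \<in> paths T'"
    unfolding p(1) paths_def pathin_def by (simp del: restrict_apply)
next
  fix K U assume K: "compact K" "K \<subseteq> \<I>" and U: "openin T' U"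
  let ?E = "{p \<in> topspace (prod_topology Z (path_space T)).
              (case p of (z, \<omega>) \<Rightarrow> \<lambda>s\<in>\<I>. h (z, \<omega> s)) ` K \<subseteq> U}"
  have E: "(z, \<omega>) \<in> ?E \<longleftrightarrow> z \<in> topspace Z \<and> \<omega> \<in> paths T \<and> (\<forall>s\<in>K. h (z, \<omega> s) \<in> U)" for z \<omega>
    using K(2) by (auto simp: image_subset_iff)
  show "openin (prod_topology Z (path_space T)) ?E"
    unfolding openin_prod_topology_alt
  proof (intro allI impI)
    fix z0 \<omega>0 assume "(z0, \<omega>0) \<in> ?E"
    then have z0: "z0 \<in> topspace Z" and \<omega>0: "\<omega>0 \<in> paths T"
      and hU: "\<And>s. s \<in> K \<Longrightarrow> h (z0, \<omega>0 s) \<in> U" unfolding E by auto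
    have c: "continuous_map (top_of_set \<I>) T \<omega>0" using \<omega>0 by (simp add: paths_def pathin_def)
    \<comment> \<open>Closed balls keep \<open>K \<inter> cball s e\<close> compact, so that mapping
      it into \<open>W\<close> is a subbasic condition on paths; the open balls of the same radius
      serve for the covering.\<close>
    have "\<exists>V W e. openin Z V \<and> openin T W \<and> e > 0 \<and> z0 \<in> V \<and>
        \<omega>0 ` (K \<inter> cball s e) \<subseteq> W \<and> (\<forall>z\<in>V. \<forall>x\<in>W. h (z, x) \<in> U)" if s: "s \<in> K" for s
    proof -
      have sI: "s \<in> \<I>" using s K(2) by blast
      then have "\<omega>0 s \<in> topspace T" using c continuous_map_funspace by fastforce
      then have in_pre: "(z0, \<omega>0 s) \<in> {p \<in> topspace (prod_topology Z T). h p \<in> U}"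
        using z0 hU[OF s] by simp
      have "openin (prod_topology Z T) {p \<in> topspace (prod_topology Z T). h p \<in> U}"
        using h U by (rule openin_continuous_map_preimage)
      from this[unfolded openin_prod_topology_alt, rule_format, OF in_pre]
      obtain V W where VW: "openin Z V" "openin T W" "z0 \<in> V" "\<omega>0 s \<in> W"
        "V \<times> W \<subseteq> {p \<in> topspace (prod_topology Z T). h p \<in> U}"
        by blast
      have "openin (top_of_set \<I>) {r \<in> topspace (top_of_set \<I>). \<omega>0 r \<in> W}"
        using c VW(2) by (rule openin_continuous_map_preimage)
      then obtain e where "e > 0" "cball s e \<inter> \<I> \<subseteq> {r \<in> topspace (top_of_set \<I>). \<omega>0 r \<in> W}"
        using sI VW(4) unfolding openin_contains_cball by auto
      then have "\<omega>0 ` (K \<inter> cball s e) \<subseteq> W" using K(2) by auto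
      then show ?thesis using VW \<open>e > 0\<close> by blast
    qed
    then have "\<forall>s\<in>K. \<exists>V W e. openin Z V \<and> openin T W \<and> e > 0 \<and> z0 \<in> V \<and>
        \<omega>0 ` (K \<inter> cball s e) \<subseteq> W \<and> (\<forall>z\<in>V. \<forall>x\<in>W. h (z, x) \<in> U)" by blast
    then obtain V W e where *: "\<forall>s\<in>K. openin Z (V s) \<and> openin T (W s) \<and> e s > 0 \<and> z0 \<in> V s \<and>
        \<omega>0 ` (K \<inter> cball s (e s)) \<subseteq> W s \<and> (\<forall>z\<in>V s. \<forall>x\<in>W s. h (z, x) \<in> U)"
      unfolding bchoice_iff by (elim exE) (rule that)
    then have VWe: "\<And>s. s \<in> K \<Longrightarrow> openin Z (V s)" "\<And>s. s \<in> K \<Longrightarrow> openin T (W s)"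
      "\<And>s. s \<in> K \<Longrightarrow> e s > 0" "\<And>s. s \<in> K \<Longrightarrow> z0 \<in> V s"
      "\<And>s. s \<in> K \<Longrightarrow> \<omega>0 ` (K \<inter> cball s (e s)) \<subseteq> W s"
      "\<And>s z x. s \<in> K \<Longrightarrow> z \<in> V s \<Longrightarrow> x \<in> W s \<Longrightarrow> h (z, x) \<in> U"
      by simp_all
    have "K \<subseteq> (\<Union>s\<in>K. ball s (e s))" using VWe(3) by auto
    then obtain D where D: "D \<subseteq> K" "finite D" "K \<subseteq> (\<Union>s\<in>D. ball s (e s))"
      using compactE_image[OF K(1), of K "\<lambda>s. ball s (e s)"] by auto
    define N where "N s = {\<omega> \<in> paths T. \<omega> ` (K \<inter> cball s (e s)) \<subseteq> W s}" for s
    have "openin (path_space T) (N s)" if "s \<in> K" for s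
      unfolding N_def using K VWe(2)[OF that] by (intro openin_path_space_basic) auto
    \<comment> \<open>If \<open>K\<close> is empty then so is \<open>D\<close>, and the intersection
      over \<open>D\<close> is \<open>UNIV\<close>; intersecting with the whole space keeps the set
      open in that case too.\<close>
    then have "openin (path_space T) ((\<Inter>s\<in>D. N s) \<inter> paths T)"
      using D openin_INT[of D "path_space T" N] by auto
    moreover have "openin Z ((\<Inter>s\<in>D. V s) \<inter> topspace Z)"
      using D VWe(1) by auto
    moreover have "((\<Inter>s\<in>D. V s) \<inter> topspace Z) \<times> ((\<Inter>s\<in>D. N s) \<inter> paths T) \<subseteq> ?E"
    proof (intro subrelI)
      fix z \<omega> assume "(z, \<omega>) \<in> ((\<Inter>s\<in>D. V s) \<inter> topspace Z) \<times> ((\<Inter>s\<in>D. N s) \<inter> paths T)"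
      then have z: "z \<in> topspace Z" "\<And>s. s \<in> D \<Longrightarrow> z \<in> V s"
        and \<omega>: "\<omega> \<in> paths T" "\<And>s. s \<in> D \<Longrightarrow> \<omega> \<in> N s" by auto
      have "h (z, \<omega> r) \<in> U" if "r \<in> K" for r
      proof -
        obtain s where s: "s \<in> D" "r \<in> ball s (e s)" using D(3) \<open>r \<in> K\<close> by blast
        then have "\<omega> r \<in> W s" using \<omega>(2)[OF s(1)] \<open>r \<in> K\<close> by (auto simp: N_def)
        then show ?thesis using VWe(6) s(1) D(1) z(2) by blast
      qed
      then show "(z, \<omega>) \<in> ?E" unfolding E using z \<omega> by blast
    qed
    moreover have "z0 \<in> (\<Inter>s\<in>D. V s) \<inter> topspace Z" using z0 VWe(4) D(1) by blast
    moreover have "\<omega>0 \<in> (\<Inter>s\<in>D. N s) \<inter> paths T"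
      unfolding N_def using \<omega>0 VWe(5) D(1) by blast
    ultimately show "\<exists>V' N'. openin Z V' \<and> openin (path_space T) N' \<and> z0 \<in> V' \<and> \<omega>0 \<in> N' \<and>
        V' \<times> N' \<subseteq> ?E" by blast
  qed
qed

lemma continuous_map_path_space_compose:
  assumes "continuous_map T T' f"
  shows "continuous_map (path_space T) (path_space T') (compose \<I> f)"
proof -
  \<comment> \<open>A single map is a family over a one-point parameter space.\<close>
  let ?Z = "discrete_topology {()}"
  have "continuous_map (prod_topology ?Z T) T' (f \<circ> snd)"
    by (rule continuous_map_compose[OF continuous_map_snd assms])
  from continuous_map_path_space_parametrized[OF this]
  have F: "continuous_map (prod_topology ?Z (path_space T)) (path_space T')
      (\<lambda>(z, \<omega>). \<lambda>s\<in>\<I>. (f \<circ> snd) (z, \<omega> s))" .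
  have "continuous_map (path_space T) (prod_topology ?Z (path_space T)) (\<lambda>\<omega>. ((), \<omega>))"
    by (intro continuous_map_pairedI) auto
  from continuous_map_compose[OF this F] show ?thesis
    by (simp add: o_def compose_def[abs_def])
qed

section \<open>Spaces of d-paths between two points\<close>

lemma topspace_dpath_space:
  "d_space X \<Longrightarrow> topspace (dpath_space X a b) = {\<omega> \<in> dpaths X. \<omega> 0 = a \<and> \<omega> 1 = b}"
  using d_space_dpaths(1) by (auto simp: dpath_space_def)

lemma continuous_map_dpath_space_compose:
  assumes "d_space X" "d_map X Y f"
  shows "continuous_map (dpath_space X a b) (dpath_space Y (f a) (f b)) (compose \<I> f)"
  unfolding dpath_space_def
proof (rule continuous_map_into_subtopology)
  show "continuous_map (subtopology (path_space (dtop X)) {\<omega> \<in> dpaths X. \<omega> 0 = a \<and> \<omega> 1 = b})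
      (path_space (dtop Y)) (compose \<I> f)"
    using assms(2) by (intro continuous_map_from_subtopology continuous_map_path_space_compose)
      (simp add: d_map_def)
qed (use d_map_dpaths[OF assms(2)] in \<open>auto simp: compose_def\<close>)

text \<open>The homotopy sends \<open>(t, \<omega>)\<close> to \<open>h (t, \<omega> s)\<close> as a
  function of \<open>s\<close>. It stays in the d-path space: each \<open>h (t, -)\<close> is a
  d-map and fixes \<open>a\<close> and \<open>b\<close>.\<close>

lemma dpath_space_homotopic:
  assumes X: "d_space X" and S: "S \<subseteq> dpoints X" and hom: "dihomotopic_rel S X X k id"
    and a: "a \<in> S" and b: "b \<in> S"
  shows "homotopic_with (\<lambda>_. True) (dpath_space X a b) (dpath_space X a b) (compose \<I> k) id"
proof -
  obtain h where h: "continuous_map (prod_topology (top_of_set \<I>) (dtop X)) (dtop X) h"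
    "\<And>x. x \<in> dpoints X \<Longrightarrow> h (0, x) = k x" "\<And>x. x \<in> dpoints X \<Longrightarrow> h (1, x) = x"
    "\<And>t. t \<in> \<I> \<Longrightarrow> d_map X X (\<lambda>x. h (t, x))" "\<And>t x. t \<in> \<I> \<Longrightarrow> x \<in> S \<Longrightarrow> h (t, x) = x"
    using hom unfolding dihomotopic_rel_iff[OF X S] id_apply by blast
  let ?P = "{\<omega> \<in> dpaths X. \<omega> 0 = a \<and> \<omega> 1 = b}"
  let ?H = "\<lambda>(t, \<omega>). \<lambda>s\<in>\<I>. h (t, \<omega> s)"
  have "(\<lambda>s\<in>\<I>. h (t, \<omega> s)) \<in> dpaths X" if "t \<in> \<I>" "\<omega> \<in> dpaths X" for t \<omega>
    using d_map_dpaths[OF h(4) that(2)] that by (simp add: compose_def)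
  then have "continuous_map (prod_topology (top_of_set \<I>) (dpath_space X a b)) (dpath_space X a b) ?H"
    unfolding dpath_space_def prod_topology_subtopology(2) continuous_map_in_subtopology
    using continuous_map_from_subtopology[OF continuous_map_path_space_parametrized[OF h(1)]] h(5) a b
    by (intro conjI) auto
  moreover have "?H (0, \<omega>) = compose \<I> k \<omega> \<and> ?H (1, \<omega>) = id \<omega>" if "\<omega> \<in> ?P" for \<omega>
  proof -
    \<comment> \<open>At \<open>t = 1\<close> the restricted function is \<open>\<omega>\<close>
      itself, since \<open>\<omega>\<close> is \<open>undefined\<close> outside the
      interval.\<close>
    have "\<omega> \<in> extensional \<I>" "\<omega> \<in> \<I> \<rightarrow> dpoints X"
      using d_space_dpaths[OF X] that by auto
    then show ?thesis
      using h(2)[OF Pi_mem[of \<omega>]] h(3)[OF Pi_mem[of \<omega>]]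
      by (simp add: compose_def fun_eq_iff extensional_def del: atLeastAtMost_iff)
  qed
  ultimately show ?thesis
    by (subst homotopic_with) (auto simp: topspace_dpath_space[OF X] intro!: exI[of _ ?H])
qed

lemma dpath_space_homotopy_equivalence:
  assumes X: "d_space X" and Y: "d_space Y" and f: "d_map X Y f" and g: "d_map Y X g"
    and S: "S \<subseteq> dpoints X" and T: "T \<subseteq> dpoints Y" and fS: "f ` S \<subseteq> T"
    and gf: "dihomotopic_rel S X X (g \<circ> f) id" and fg: "dihomotopic_rel T Y Y (f \<circ> g) id"
    and a: "a \<in> S" and b: "b \<in> S"
  shows "homotopy_equivalence_map (dpath_space X a b) (dpath_space Y (f a) (f b)) (compose \<I> f)"
proof -
  \<comment> \<open>Hence \<open>compose \<I> g\<close> leads back to the d-path space with the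
    original end points.\<close>
  have "g (f a) = a" "g (f b) = b" using gf a b by (simp_all add: dihomotopic_rel_alt)
  then have "continuous_map (dpath_space Y (f a) (f b)) (dpath_space X a b) (compose \<I> g)"
    using continuous_map_dpath_space_compose[OF Y g, of "f a" "f b"] by simp
  moreover have "compose \<I> g \<circ> compose \<I> f = compose \<I> (g \<circ> f)"
    "compose \<I> f \<circ> compose \<I> g = compose \<I> (f \<circ> g)"
    by (auto simp: fun_eq_iff compose_def)
  moreover have "f a \<in> T" "f b \<in> T" using fS a b by auto
  ultimately show ?thesis
    unfolding homotopy_equivalence_map_def
    using continuous_map_dpath_space_compose[OF X f] dpath_space_homotopic[OF X S gf a b]
      dpath_space_homotopic[OF Y T fg] by metis
qed

section \<open>Extremal points of the realization\<close>

text \<open>A predicate respected by the generating identifications is constant on each class. This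
  is how all representatives of a vertex point are controlled below.\<close>

lemma equivclp_glue_invariant:
  assumes "equivclp (glue P) p q" "\<And>p q. glue P p q \<Longrightarrow> R p \<longleftrightarrow> R q"
  shows "R p \<longleftrightarrow> R q"
  using assms(1) by (induction rule: equivclp_induct) (use assms(2) in blast)+

lemma rclass_eqD:
  assumes "rclass P p = rclass P q"
  shows "equivclp (glue P) p q"
proof -
  have "q \<in> rclass P q" by (simp add: rclass_def equivclp_def)
  then have "q \<in> rclass P p" unfolding assms .
  then show ?thesis by (simp add: rclass_def)
qed

lemma rclass_eqI:
  assumes "equivclp (glue P) p q"
  shows "rclass P p = rclass P q"
  using equivclp_trans[OF assms] equivclp_trans[OF equivclp_sym[OF assms]]
  unfolding rclass_def by blast

lemma rclass_glue: "glue P p q \<Longrightarrow> rclass P p = rclass P q"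
  by (rule rclass_eqI) (simp add: equivclp_def r_into_rtranclp symclpI)

lemma dpoints_realization:
  "dpoints (realization P) = {rclass P ((n, x), u) | n x u. x \<in> cells P n \<and> u \<in> topspace (cube n)}"
proof -
  have "dpoints (realization P) = rclass P ` topspace (cube_sum P)"
    using quotient_imp_surjective_map[OF quotient_map_rclass, of P] by (simp add: realization_def)
  also have "\<dots> = {rclass P ((n, x), u) | n x u. x \<in> cells P n \<and> u \<in> topspace (cube n)}"
    unfolding cube_sum_def topspace_sum_topology by (auto simp: image_iff) blast
  finally show ?thesis .
qed

lemma rclass_in_dpoints:
  "x \<in> cells P n \<Longrightarrow> u \<in> topspace (cube n) \<Longrightarrow> rclass P ((n, x), u) \<in> dpoints (realization P)"
  unfolding dpoints_realization by blast

section \<open>Lowest and highest corners of cubes and cells\<close>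

lemma topspace_cube: "topspace (cube n) = ({1..n} \<rightarrow>\<^sub>E \<I>)"
  by (simp add: cube_def)

text \<open>The lowest (\<open>k = 0\<close>) or highest (\<open>k = 1\<close>) corner of the cube;
  \<open>k\<close> is a natural number to match the index of the boundary operators.\<close>

definition const_point :: "nat \<Rightarrow> nat \<Rightarrow> nat \<Rightarrow> real" where
  "const_point n k = (\<lambda>i\<in>{1..n}. real k)"

lemma const_point_0 [simp]: "const_point 0 k = (\<lambda>_. undefined)"
  by (auto simp: const_point_def)

lemma const_point_cube: "k \<in> {0, 1} \<Longrightarrow> const_point n k \<in> topspace (cube n)"
  by (auto simp: const_point_def topspace_cube)

lemma cube_face_const_point:
  assumes "i \<in> {1..n + 1}"
  shows "cube_face n i k (const_point n k) = const_point (n + 1) k"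
  using assms by (auto simp: cube_face_def const_point_def fun_eq_iff)

lemma cube_face_eq_const_point:
  assumes "u \<in> topspace (cube n)" "i \<in> {1..n + 1}" "cube_face n i l u = const_point (n + 1) k"
  shows "l = k" "u = const_point n k"
proof -
  have e: "(if j < i then u j else if j = i then real l else u (j - 1)) = real k"
    if "j \<in> {1..n + 1}" for j
    using fun_cong[OF assms(3), of j] that by (simp add: cube_face_def const_point_def)
  from e[of i] assms(2) show "l = k" by simp
  \<comment> \<open>Coordinate \<open>j\<close> of \<open>u\<close> reappears in the face at
    position \<open>j\<close> if \<open>j < i\<close>, and at position \<open>j + 1\<close>
    otherwise.\<close>
  have "u j = real k" if "j \<in> {1..n}" for j
    using e[of j] e[of "j + 1"] that by (cases "j < i") (auto split: if_splits)
  then show "u = const_point n k"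
    using assms(1) by (auto simp: const_point_def topspace_cube PiE_iff extensional_def)
qed

text \<open>The vertex of an \<open>n\<close>-cell at \<open>(k,...,k)\<close>, computed by always
  removing the first coordinate; by \<open>corner_face\<close> below, removing another coordinate
  first gives the same vertex.\<close>

fun corner :: "'a precubical \<Rightarrow> nat \<Rightarrow> nat \<Rightarrow> 'a \<Rightarrow> 'a" where
  "corner P k 0 x = x"
| "corner P k (Suc n) x = corner P k n (face P (Suc n) 1 k x)"

lemma face_in_cells:
  assumes "precubical_set P" "x \<in> cells P (Suc n)" "i \<in> {1..Suc n}" "k \<in> {0, 1}"
  shows "face P (Suc n) i k x \<in> cells P n"
proof -
  have "\<forall>n\<ge>1. \<forall>i\<in>{1..n}. \<forall>k\<in>{0,1}. \<forall>x\<in>cells P n. face P n i k x \<in> cells P (n - 1)"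
    using assms(1) unfolding precubical_set_def by (elim conjE)
  then have "face P (Suc n) i k x \<in> cells P (Suc n - 1)"
    using assms(2-4) by (metis le_add1 plus_1_eq_Suc)
  then show ?thesis by simp
qed

lemma face_face:
  assumes "precubical_set P" "x \<in> cells P (Suc (Suc n))" "1 \<le> i" "i < j" "j \<le> Suc (Suc n)"
    "k \<in> {0, 1}" "l \<in> {0, 1}"
  shows "face P (Suc n) i k (face P (Suc (Suc n)) j l x) =
    face P (Suc n) (j - 1) l (face P (Suc (Suc n)) i k x)"
proof -
  have "\<forall>n\<ge>2. \<forall>j\<in>{1..n}. \<forall>i\<in>{1..<j}. \<forall>k\<in>{0,1}. \<forall>l\<in>{0,1}. \<forall>x\<in>cells P n.
        face P (n - 1) i k (face P n j l x) = face P (n - 1) (j - 1) l (face P n i k x)"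
    using assms(1) unfolding precubical_set_def by (elim conjE)
  from this[rule_format, of "Suc (Suc n)" j i k l x] show ?thesis using assms(2-) by simp
qed

lemma corner_in_cells:
  "precubical_set P \<Longrightarrow> k \<in> {0, 1} \<Longrightarrow> x \<in> cells P n \<Longrightarrow> corner P k n x \<in> cells P 0"
proof (induction n arbitrary: x)
  case (Suc n)
  then have "face P (Suc n) 1 k x \<in> cells P n" by (intro face_in_cells) auto
  with Suc show ?case by simp
qed simp

text \<open>For \<open>i > 1\<close> the precubical identity exchanges the two faces, turning
  direction \<open>i\<close> into direction \<open>i - 1\<close> of the first face, where induction
  applies.\<close>

lemma corner_face:
  "precubical_set P \<Longrightarrow> k \<in> {0, 1} \<Longrightarrow> x \<in> cells P (Suc n) \<Longrightarrow> i \<in> {1..Suc n} \<Longrightarrow>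
     corner P k n (face P (Suc n) i k x) = corner P k (Suc n) x"
proof (induction n arbitrary: x i)
  case (Suc n)
  show ?case
  proof (cases "i = 1")
    case False
    have 1: "face P (Suc (Suc n)) 1 k x \<in> cells P (Suc n)"
      using Suc.prems by (intro face_in_cells) auto
    have "corner P k (Suc n) (face P (Suc (Suc n)) i k x) =
        corner P k n (face P (Suc n) (i - 1) k (face P (Suc (Suc n)) 1 k x))"
      using face_face[of P x n 1 i k k] Suc.prems False by simp
    also have "\<dots> = corner P k (Suc n) (face P (Suc (Suc n)) 1 k x)"
      by (rule Suc.IH) (use Suc.prems 1 False in auto)
    finally show ?thesis by simp
  qed simp
qed simp

text \<open>The edge of \<open>x\<close> in direction \<open>i\<close> at its corner \<open>(k,\<dots>,k)\<close>.\<close>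

lemma edge_at_corner:
  "precubical_set P \<Longrightarrow> k \<in> {0, 1} \<Longrightarrow> l \<in> {0, 1} \<Longrightarrow> x \<in> cells P (Suc n) \<Longrightarrow> i \<in> {1..Suc n} \<Longrightarrow>
     \<exists>e\<in>cells P 1. face P 1 1 k e = corner P k (Suc n) x \<and>
       face P 1 1 l e = corner P k n (face P (Suc n) i l x)"
proof (induction n arbitrary: x i)
  case 0
  then show ?case by (intro bexI[of _ x]) auto
next
  case (Suc n)
  show ?case
  proof (cases "i = 1")
    case True
    \<comment> \<open>The edge lies in every face of type \<open>k\<close> taken in another
      direction. For \<open>i = 1\<close> direction 2 is removed and the edge keeps direction 1;
      otherwise direction 1 is removed and the edge gets direction \<open>i - 1\<close>.\<close>
    let ?y = "face P (Suc (Suc n)) 2 k x"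
    have y: "?y \<in> cells P (Suc n)" using Suc.prems by (intro face_in_cells) auto
    have "face P (Suc n) 1 l ?y = face P (Suc n) 1 k (face P (Suc (Suc n)) 1 l x)"
      using face_face[of P x n 1 2 l k] Suc.prems by simp
    moreover have "corner P k (Suc n) ?y = corner P k (Suc (Suc n)) x"
      using Suc.prems by (intro corner_face) auto
    ultimately show ?thesis using Suc.IH[OF Suc.prems(1-3) y, of 1] True by simp
  next
    case False
    let ?y = "face P (Suc (Suc n)) 1 k x"
    have y: "?y \<in> cells P (Suc n)" using Suc.prems by (intro face_in_cells) auto
    have "face P (Suc n) 1 k (face P (Suc (Suc n)) i l x) = face P (Suc n) (i - 1) l ?y"
      using face_face[of P x n 1 i k l] Suc.prems False by simp
    moreover have "i - 1 \<in> {1..Suc n}" using Suc.prems False by auto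
    ultimately show ?thesis using Suc.IH[OF Suc.prems(1-3) y] by simp
  qed
qed

text \<open>The corner of a cube is the image of the corner of its first face, so gluing removes one
  coordinate at a time, exactly as \<open>corner\<close> does.\<close>

lemma rclass_const_point:
  "precubical_set P \<Longrightarrow> k \<in> {0, 1} \<Longrightarrow> x \<in> cells P n \<Longrightarrow>
     rclass P ((n, x), const_point n k) = vertex_point P (corner P k n x)"
proof (induction n arbitrary: x)
  case 0
  then show ?case by (simp add: vertex_point_def)
next
  case (Suc n)
  let ?y = "face P (Suc n) 1 k x"
  have y: "?y \<in> cells P n" using Suc.prems by (intro face_in_cells) auto
  have "glue P ((n, ?y), const_point n k) ((Suc n, x), const_point (Suc n) k)"
    unfolding glue_def using Suc.prems const_point_cube[of k n] cube_face_const_point[of 1 n k]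
    by (intro exI[of _ n] bexI[of _ x] bexI[of _ "const_point n k"] bexI[of _ 1] bexI[of _ k]) auto
  from rclass_glue[OF this] Suc.IH[OF Suc.prems(1,2) y] show ?case by simp
qed

section \<open>Extremality of vertices and of points\<close>

text \<open>Minimality for \<open>k = 0\<close> and maximality for \<open>k = 1\<close>, treated uniformly.\<close>

definition end_vertex :: "'a precubical \<Rightarrow> nat \<Rightarrow> 'a \<Rightarrow> bool" where
  "end_vertex P k v \<longleftrightarrow> v \<in> cells P 0 \<and> (\<nexists>x. x \<in> cells P 1 \<and> face P 1 1 (1 - k) x = v)"

definition end_point :: "'b dspace \<Rightarrow> nat \<Rightarrow> 'b \<Rightarrow> bool" where
  "end_point X k a \<longleftrightarrow> a \<in> dpoints X \<and>
     (\<forall>\<omega>\<in>dpaths X. \<omega> (1 - real k) = a \<longrightarrow> \<omega> (real k) = a)"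

lemma minimal_vertex_iff: "minimal_vertex P v \<longleftrightarrow> end_vertex P 0 v"
  and maximal_vertex_iff: "maximal_vertex P v \<longleftrightarrow> end_vertex P 1 v"
  by (simp_all add: minimal_vertex_def maximal_vertex_def end_vertex_def)

text \<open>A morphism of the fundamental category is the class of a d-path between objects, so
  quantifying over morphisms amounts to quantifying over d-paths. A d-path is at \<open>a\<close> at
  time \<open>1 - k\<close>: its end for minimality, its start for maximality.\<close>

lemma extremal_points_iff:
  assumes "d_space X"
  shows "a \<in> extremal_points X \<longleftrightarrow> end_point X 0 a \<or> end_point X 1 a"
proof -
  have "\<omega> 0 \<in> dpoints X" "\<omega> 1 \<in> dpoints X" if "\<omega> \<in> dpaths X" for \<omega>
    using d_space_dpaths(3)[OF assms that] by auto
  then have "minimal_point X a \<longleftrightarrow> end_point X 0 a" "maximal_point X a \<longleftrightarrow> end_point X 1 a"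
    by (auto simp: minimal_point_def maximal_point_def end_point_def pi1_def)
  then show ?thesis by (simp add: extremal_points_def)
qed

text \<open>Gluing along a face of type \<open>k\<close> preserves both the corner of the cell and
  the corner position of the point. Gluing along a face of the opposite type would yield an edge
  that \<open>end_vertex\<close> forbids.\<close>

lemma rclass_eq_end_vertex:
  assumes P: "precubical_set P" and k: "k \<in> {0, 1}" and v: "end_vertex P k v"
    and eq: "rclass P ((n, x), u) = vertex_point P v"
  shows "u = const_point n k"
proof -
  \<comment> \<open>The invariant also records that the corner of the cell is \<open>v\<close>: this
    supplies the forbidden edge when passing to a higher cell.\<close>
  define R where "R = (\<lambda>((n, x), u). x \<in> cells P n \<and> corner P k n x = v \<and> u = const_point n k)"
  have inv: "R p \<longleftrightarrow> R q" if "glue P p q" for p q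
  proof -
    from that obtain n x u i l where *: "x \<in> cells P (n + 1)" "u \<in> topspace (cube n)"
        "i \<in> {1..n + 1}" "l \<in> {0, 1}" and
      pq: "p = ((n, face P (n + 1) i l x), u)" "q = ((n + 1, x), cube_face n i l u)"
      unfolding glue_def by blast
    have f: "face P (Suc n) i l x \<in> cells P n" using * P by (intro face_in_cells) auto
    show ?thesis
    proof
      assume "R p"
      then have 1: "corner P k n (face P (Suc n) i l x) = v" "u = const_point n k"
        by (simp_all add: R_def pq)
      have "l = k"
      proof (rule ccontr)
        assume "l \<noteq> k"
        then have "l = 1 - k" using *(4) k by auto
        moreover obtain e where "e \<in> cells P 1" "face P 1 1 l e = v"
          using edge_at_corner[OF P k *(4), of x n i] * 1 by auto
        ultimately show False using v by (auto simp: end_vertex_def)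
      qed
      then show "R q"
        using corner_face[OF P k, of x n i] cube_face_const_point[OF *(3), of k] * 1
        by (simp add: R_def pq)
    next
      assume "R q"
      then have 1: "corner P k (Suc n) x = v" "cube_face n i l u = const_point (n + 1) k"
        by (simp_all add: R_def pq)
      from cube_face_eq_const_point[OF *(2,3) 1(2)] show "R p"
        using corner_face[OF P k, of x n i] * 1 f by (simp add: R_def pq)
    qed
  qed
  have "R ((0, v), \<lambda>_. undefined)"
    using v by (simp add: R_def end_vertex_def)
  moreover have "equivclp (glue P) ((0, v), \<lambda>_. undefined) ((n, x), u)"
    using rclass_eqD[OF eq[unfolded vertex_point_def, symmetric]] .
  ultimately have "R ((n, x), u)" using equivclp_glue_invariant[of P _ _ R] inv by blast
  then show ?thesis by (simp add: R_def)
qed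

text \<open>Passing to a face only inserts or removes a coordinate equal to 0 or 1. The lemma serves
  to separate the midpoint of an edge from all vertices.\<close>

lemma rclass_eq_vertex:
  assumes "rclass P ((n, x), u) = vertex_point P v"
  shows "\<forall>i\<in>{1..n}. u i \<in> {0, 1}"
proof -
  define R where "R = (\<lambda>((n :: nat, x :: 'a), u :: nat \<Rightarrow> real). \<forall>i\<in>{1..n}. u i \<in> {0, 1})"
  have inv: "R p \<longleftrightarrow> R q" if "glue P p q" for p q
  proof -
    from that obtain n x u i l where *: "i \<in> {1..n + 1}" "l \<in> {0, 1}" and
      pq: "p = ((n, face P (n + 1) i l x), u)" "q = ((n + 1, x), cube_face n i l u)"
      unfolding glue_def by blast
    have "(\<forall>j\<in>{1..n}. u j \<in> {0, 1}) \<longleftrightarrow> (\<forall>j\<in>{1..n + 1}. cube_face n i l u j \<in> {0, 1})"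
      (is "?L \<longleftrightarrow> ?R")
    proof
      assume L: ?L
      show ?R
      proof
        fix j assume j: "j \<in> {1..n + 1}"
        consider "j < i" | "j = i" | "j > i" by linarith
        then show "cube_face n i l u j \<in> {0, 1}"
        proof cases
          case 1 then show ?thesis using L[rule_format, of j] j * by (auto simp: cube_face_def)
        next
          case 2 then show ?thesis using * by (auto simp: cube_face_def)
        next
          case 3
          then have "j - 1 \<in> {1..n}" using j * by auto
          then show ?thesis using L 3 j by (auto simp: cube_face_def)
        qed
      qed
    next
      assume R: ?R
      show ?L
      proof
        fix j assume "j \<in> {1..n}"
        then show "u j \<in> {0, 1}"
          using R[rule_format, of j] R[rule_format, of "j + 1"] *
          by (cases "j < i") (auto simp: cube_face_def split: if_splits)
      qed
    qed
    then show ?thesis by (simp add: R_def pq)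
  qed
  have "equivclp (glue P) ((0, v), \<lambda>_. undefined) ((n, x), u)"
    using rclass_eqD[OF assms[unfolded vertex_point_def, symmetric]] .
  moreover have "R ((0, v), \<lambda>_. undefined)" by (simp add: R_def)
  ultimately have "R ((n, x), u)" using equivclp_glue_invariant[of P _ _ R] inv by blast
  then show ?thesis by (simp add: R_def)
qed

section \<open>D-paths through cubes and end vertices\<close>

lemma line_dpath:
  assumes "x \<in> cells P n" "u \<in> topspace (cube n)" "w \<in> topspace (cube n)"
    and le: "\<And>i. i \<in> {1..n} \<Longrightarrow> u i \<le> w i"
  obtains \<omega> where "\<omega> \<in> dpaths (realization P)" "\<omega> 0 = rclass P ((n, x), u)" "\<omega> 1 = rclass P ((n, x), w)"
proof
  define \<beta> where "\<beta> t = (\<lambda>i\<in>{1..n}. (1 - t) * u i + t * w i)" for t :: real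
  have uw: "u i \<in> \<I>" "w i \<in> \<I>" if "i \<in> {1..n}" for i
    using assms(2,3) that by (auto simp: topspace_cube PiE_iff)
  have in_I: "(1 - t) * u i + t * w i \<in> \<I>" if "t \<in> \<I>" "i \<in> {1..n}" for t i
    using convexD_alt[of \<I> "u i" "w i" t] uw[OF that(2)] that(1) by auto
  have "continuous_map (top_of_set \<I>) (cube n) \<beta>"
    unfolding cube_def continuous_map_componentwise
  proof (intro conjI ballI)
    show "\<beta> ` topspace (top_of_set \<I>) \<subseteq> extensional {1..n}" by (auto simp: \<beta>_def)
    fix i assume i: "i \<in> {1..n}"
    have "continuous_on \<I> (\<lambda>t. (1 - t) * u i + t * w i)" by (intro continuous_intros)
    then show "continuous_map (top_of_set \<I>) (top_of_set \<I>) (\<lambda>t. \<beta> t i)"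
      using in_I[OF _ i] i by (auto simp: \<beta>_def)
  qed
  then have "continuous_map (top_of_set \<I>) (cube n) (restrict \<beta> \<I>)"
    by (rule continuous_map_eq) simp
  then have p: "restrict \<beta> \<I> \<in> paths (cube n)"
    unfolding paths_def pathin_def by (simp del: restrict_apply)
  have "\<beta> s i \<le> \<beta> t i" if "s \<in> \<I>" "t \<in> \<I>" "s \<le> t" "i \<in> {1..n}" for s t i
  proof -
    \<comment> \<open>This product is the increment of coordinate \<open>i\<close> between times
      \<open>s\<close> and \<open>t\<close>.\<close>
    have "0 \<le> (t - s) * (w i - u i)" using that le[OF that(4)] by simp
    then show ?thesis using that(4) by (simp add: \<beta>_def algebra_simps)
  qed
  then have c: "(\<lambda>t\<in>\<I>. rclass P ((n, x), restrict \<beta> \<I> t)) \<in> cube_path_concats P" (is "?\<omega> \<in> _")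
    by (intro cube_path_concats.cube_path assms(1) p) auto
  \<comment> \<open>D-paths are defined as reparametrized concatenations, so the identity is
    supplied as the reparametrization.\<close>
  have "?\<omega> = compose \<I> ?\<omega> (\<lambda>t\<in>\<I>. t)" by (auto simp: compose_def fun_eq_iff)
  with c restrict_id_increasing show "?\<omega> \<in> dpaths (realization P)"
    unfolding realization_def dspace.select_convs by blast
  have "\<beta> 0 = u" "\<beta> 1 = w"
    using assms(2,3) by (auto simp: \<beta>_def topspace_cube PiE_iff extensional_def fun_eq_iff)
  then show "?\<omega> 0 = rclass P ((n, x), u)" "?\<omega> 1 = rclass P ((n, x), w)" by simp_all
qed

text \<open>In one cube the path is at the corner \<open>(k,...,k)\<close> at time
  \<open>1 - k\<close>; monotonicity and the bounds of the cube then force it to be there at time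
  \<open>k\<close> too. In a concatenation the vertex is passed on through the common point.\<close>

lemma cube_path_concats_end_vertex:
  assumes P: "precubical_set P" and k: "k \<in> {0, 1}" and v: "end_vertex P k v"
    and "\<omega> \<in> cube_path_concats P" "\<omega> (1 - real k) = vertex_point P v"
  shows "\<omega> (real k) = vertex_point P v"
  using assms(4,5)
proof (induction rule: cube_path_concats.induct)
  case (cube_path x n \<alpha>)
  have "\<alpha> t \<in> topspace (cube n)" if "t \<in> \<I>" for t
    using cube_path(2) continuous_map_funspace that unfolding paths_def pathin_def by fastforce
  then have c: "\<alpha> t \<in> {1..n} \<rightarrow>\<^sub>E \<I>" if "t \<in> \<I>" for t using that by (simp add: topspace_cube)
  have kI: "real k \<in> \<I>" "1 - real k \<in> \<I>" using k by auto
  have "rclass P ((n, x), \<alpha> (1 - real k)) = vertex_point P v"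
    using cube_path.prems kI by simp
  from rclass_eq_end_vertex[OF P k v this]
  have e: "\<alpha> (1 - real k) = const_point n k" .
  have "\<alpha> (real k) i = real k" if i: "i \<in> {1..n}" for i
  proof -
    have "\<alpha> 0 i \<le> \<alpha> 1 i" using cube_path(3) i by auto
    moreover have "\<alpha> (1 - real k) i = real k" using i by (simp add: e const_point_def)
    moreover have "\<alpha> (real k) i \<in> \<I>" using c[OF kI(1)] i by blast
    ultimately show ?thesis using k by auto
  qed
  then have "\<alpha> (real k) = const_point n k"
    using c[OF kI(1)] by (auto simp: const_point_def PiE_iff extensional_def fun_eq_iff)
  then show ?case using cube_path.prems kI e by simp
next
  case (concat \<omega> \<nu>)
  then show ?case using k by auto
qed

lemma end_point_realization:
  assumes P: "precubical_set P" and k: "k \<in> {0, 1}"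
  shows "end_point (realization P) k a \<longleftrightarrow> (\<exists>v. end_vertex P k v \<and> a = vertex_point P v)"
proof
  assume "\<exists>v. end_vertex P k v \<and> a = vertex_point P v"
  then obtain v where v: "end_vertex P k v" "a = vertex_point P v" by blast
  have "(\<lambda>_. undefined) \<in> topspace (cube 0)" by (simp add: topspace_cube)
  then have "a \<in> dpoints (realization P)"
    using v rclass_in_dpoints[of v P 0] by (simp add: vertex_point_def end_vertex_def)
  moreover have "\<omega> (real k) = a" if \<omega>: "\<omega> \<in> dpaths (realization P)" "\<omega> (1 - real k) = a" for \<omega>
  proof -
    \<comment> \<open>Normalization makes the end points of \<open>\<omega>\<close> those of the
      concatenation \<open>\<nu>\<close>, to which the previous lemma applies.\<close>
    obtain \<nu> \<psi> where \<nu>: "\<nu> \<in> cube_path_concats P" "\<psi> 0 = 0" "\<psi> 1 = 1" "\<omega> = compose \<I> \<nu> \<psi>"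
      using \<omega>(1) cube_path_concats_normalize[of _ P] by (simp add: realization_def) metis
    then have "\<omega> (real k) = \<nu> (real k)" "\<omega> (1 - real k) = \<nu> (1 - real k)"
      using k by (auto simp: compose_def)
    then show ?thesis
      using cube_path_concats_end_vertex[OF P k v(1) \<nu>(1)] \<omega>(2) v(2) by simp
  qed
  ultimately show "end_point (realization P) k a" by (simp add: end_point_def)
next
  assume a: "end_point (realization P) k a"
  \<comment> \<open>Within a cube, moving down (\<open>k = 0\<close>) or up (\<open>k = 1\<close>)
    from a representative of \<open>a\<close> follows a straight d-path that ends or starts at
    \<open>a\<close>, so the point reached is \<open>a\<close> again.\<close>
  have end_eq: "rclass P ((n, x), w) = a"
    if a_eq: "a = rclass P ((n, x), u)" and x: "x \<in> cells P n"
      and u: "u \<in> topspace (cube n)" and w: "w \<in> topspace (cube n)"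
      and le: "\<And>i. i \<in> {1..n} \<Longrightarrow> if k = 0 then w i \<le> u i else u i \<le> w i" for n x u w
  proof (cases "k = 0")
    case True
    then obtain \<omega> where "\<omega> \<in> dpaths (realization P)" "\<omega> 0 = rclass P ((n, x), w)" "\<omega> 1 = a"
      using line_dpath[OF x w u] le a_eq by metis
    then show ?thesis using a True by (auto simp: end_point_def)
  next
    case False
    then obtain \<omega> where "\<omega> \<in> dpaths (realization P)" "\<omega> 0 = a" "\<omega> 1 = rclass P ((n, x), w)"
      using line_dpath[OF x u w] le a_eq by metis
    then show ?thesis using a False k by (auto simp: end_point_def)
  qed
  obtain n x u where x: "x \<in> cells P n" "u \<in> topspace (cube n)" "a = rclass P ((n, x), u)"
    using a unfolding end_point_def dpoints_realization by blast
  have "rclass P ((n, x), const_point n k) = a"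
    by (rule end_eq[OF x(3,1,2) const_point_cube[OF k]])
      (use x(2) k in \<open>auto simp: const_point_def topspace_cube PiE_iff\<close>)
  then have av: "a = vertex_point P (corner P k n x)"
    using rclass_const_point[OF P k x(1)] by simp
  moreover have "end_vertex P k (corner P k n x)"
    unfolding end_vertex_def
  proof (intro conjI notI)
    show "corner P k n x \<in> cells P 0" by (rule corner_in_cells[OF P k x(1)])
    assume "\<exists>e. e \<in> cells P 1 \<and> face P 1 1 (1 - k) e = corner P k n x"
    then obtain e where e: "e \<in> cells P 1" "face P 1 1 (1 - k) e = corner P k n x" by blast
    have k': "1 - k \<in> {0, 1}" using k by auto
    have "corner P (1 - k) 1 e = corner P k n x" using e(2) by simp
    then have "a = rclass P ((1, e), const_point 1 (1 - k))"
      using rclass_const_point[OF P k' e(1)] av by simp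
    \<comment> \<open>The forbidden edge would identify its midpoint with the vertex
      \<open>a\<close>, but the coordinate 1/2 is neither 0 nor 1.\<close>
    then have "rclass P ((1, e), \<lambda>i\<in>{1..1}. 1/2) = a"
      by (rule end_eq[OF _ e(1) const_point_cube[OF k']])
        (use k in \<open>auto simp: topspace_cube const_point_def\<close>)
    from rclass_eq_vertex[OF this[unfolded av]] show False by simp
  qed
  ultimately show "\<exists>v. end_vertex P k v \<and> a = vertex_point P v" by blast
qed

lemma cells_Extrl: "cells (Extrl P) 0 = {v. end_vertex P 0 v \<or> end_vertex P 1 v}"
  by (simp add: Extrl_def minimal_vertex_iff maximal_vertex_iff)

lemma extremal_points_realization:
  assumes "precubical_set P"
  shows "extremal_points (realization P) = vertex_point P ` cells (Extrl P) 0"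
proof (rule set_eqI)
  fix a
  show "a \<in> extremal_points (realization P) \<longleftrightarrow> a \<in> vertex_point P ` cells (Extrl P) 0"
    unfolding extremal_points_iff[OF d_space_realization] cells_Extrl
    using end_point_realization[OF assms, of 0 a] end_point_realization[OF assms, of 1 a]
    by auto
qed

lemma dpoints_realization_Extrl:
  "dpoints (realization (Extrl P)) = vertex_point (Extrl P) ` cells (Extrl P) 0"
proof -
  have "cells (Extrl P) n = {}" if "n \<noteq> 0" for n using that by (simp add: Extrl_def)
  then have "x \<in> cells (Extrl P) n \<Longrightarrow> n = 0" for n x by fastforce
  moreover have "topspace (cube 0) = {\<lambda>_. undefined}" by (simp add: topspace_cube)
  ultimately show ?thesis
    unfolding dpoints_realization vertex_point_def by (auto simp: image_iff) force+
qed

lemma realization_incl_vertex_point: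
  "realization_incl P (vertex_point (Extrl P) v) = vertex_point P v"
  unfolding vertex_point_def by (rule realization_incl_rclass[OF precubical_subset_Extrl])

theorem corollary3p9:
  fixes P Q :: "'a precubical" and f :: "'a rpoint \<Rightarrow> 'a rpoint"
  assumes "precubical_set P" and "precubical_set Q"
    and "Extrl P = Extrl Q"
    and "dihomotopy_equivalence_rel (dpoints (realization (Extrl P)))
           (realization_incl P) (realization_incl Q) (realization P) (realization Q) f"
  shows "is_isomorphism (bipartite_graph (realization P)) (bipartite_graph (realization Q))
           (pi1_functor (realization Q) f) \<and>
         (\<forall>v\<in>cells (Extrl P) 0. \<forall>w\<in>cells (Extrl P) 0.
            homotopy_equivalence_map
              (dpath_space (realization P) (vertex_point P v) (vertex_point P w))
              (dpath_space (realization Q) (vertex_point Q v) (vertex_point Q w))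
              (compose \<I> f))"
proof -
  let ?X = "realization P" and ?Y = "realization Q" and ?V = "cells (Extrl P) 0"
  let ?S = "vertex_point P ` ?V" and ?T = "vertex_point Q ` ?V"
  \<comment> \<open>The classes of the common d-subspace are formed in \<open>Extrl P\<close>, which
    equals \<open>Extrl Q\<close>; both inclusions therefore send them to the corresponding vertex
    points.\<close>
  have incl: "realization_incl P (vertex_point (Extrl P) v) = vertex_point P v"
    "realization_incl Q (vertex_point (Extrl P) v) = vertex_point Q v" for v
    using realization_incl_vertex_point[of P] realization_incl_vertex_point[of Q] assms(3) by simp_all
  have A: "dpoints (realization (Extrl P)) = vertex_point (Extrl P) ` ?V"
    by (rule dpoints_realization_Extrl)
  have ST: "realization_incl P ` dpoints (realization (Extrl P)) = ?S"
    "realization_incl Q ` dpoints (realization (Extrl P)) = ?T"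
    unfolding A image_image incl by simp_all
  obtain g where f: "d_map ?X ?Y f" and g: "d_map ?Y ?X g"
    and fv: "\<And>v. v \<in> ?V \<Longrightarrow> f (vertex_point P v) = vertex_point Q v"
    and gv: "\<And>v. v \<in> ?V \<Longrightarrow> g (vertex_point Q v) = vertex_point P v"
    and gf: "dihomotopic_rel ?S ?X ?X (g \<circ> f) id" and fg: "dihomotopic_rel ?T ?Y ?Y (f \<circ> g) id"
    using assms(4) unfolding dihomotopy_equivalence_rel_def ST unfolding A ball_simps incl by blast
  have fS: "f ` ?S \<subseteq> ?T" and gT: "g ` ?T \<subseteq> ?S" using fv gv by auto
  \<comment> \<open>Here the two notions of extremality meet: the sets that the dihomotopies fix are
    the object sets of the bipartite graphs.\<close>
  have ext: "extremal_points ?X = ?S" "extremal_points ?Y = ?T"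
    using extremal_points_realization[OF assms(1)] extremal_points_realization[OF assms(2)] assms(3)
    by simp_all
  have "extremal_points X \<subseteq> dpoints X" for X :: "'a rpoint dspace"
    by (auto simp: extremal_points_def minimal_point_def maximal_point_def)
  then have dp: "?S \<subseteq> dpoints ?X" "?T \<subseteq> dpoints ?Y" using ext by metis+
  show ?thesis
  proof (intro conjI ballI)
    show "is_isomorphism (bipartite_graph ?X) (bipartite_graph ?Y) (pi1_functor ?Y f)"
      unfolding bipartite_graph_def ext
      by (rule pi1_full_subcat_isomorphism[OF d_space_realization d_space_realization f g fS gT gf fg])
  next
    fix v w assume vw: "v \<in> ?V" "w \<in> ?V"
    show "homotopy_equivalence_map
        (dpath_space ?X (vertex_point P v) (vertex_point P w))
        (dpath_space ?Y (vertex_point Q v) (vertex_point Q w)) (compose \<I> f)"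
      using dpath_space_homotopy_equivalence[OF d_space_realization d_space_realization f g dp fS gf fg,
          of "vertex_point P v" "vertex_point P w"] vw by (simp add: fv)
  qed
qed

end
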